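(* Let $\mathbb{F}$ be a countable field, let $d\ge1$, let $\mathbf{S}=\mathbb{F}[u_1^{\pm1},\dots,u_d^{\pm1}]$ be the ring of Laurent polynomials in the commuting variables $u_1,\dots,u_d$ with coefficients in $\mathbb{F}$, and let $\mathcal{N}$ be a finitely generated $\mathbf{S}$-module. Let $K^{\mathcal{N}}$ be the (Pontryagin) dual of the discrete abelian group $\mathcal{N}$. For $\mathbf{n}=(n_1,\dots,n_d)\in\mathbb{Z}^d$ and $q\in\mathbb{F}^*=\mathbb{F}\setminus\{0\}$ let $\alpha_{\mathbf{n}}$ and $\alpha_{(q,\mathbf{n})}$ be the automorphisms of $\mathcal{N}$ given by $\alpha_{\mathbf{n}}a=u_1^{n_1}\cdots u_d^{n_d}a$ and $\alpha_{(q,\mathbf{n})}a=q\,\alpha_{\mathbf{n}}a$, and let $\Delta=\mathbb{F}^*\times\mathbb{Z}^d$ act on $K^{\mathcal{N}}$ by the automorphisms dual to $\alpha_{(q,\mathbf{n})}$. Then: (1) $\Delta$ has DCC on $K^{\mathcal{N}}$; (2) if $\Gamma$ is a finitely generated abelian group (under composition) of $\mathbf{S}$-module homomorphisms (that is, $\mathbf S$-module automorphisms) of $\mathcal{N}$ and the dual action of $\Gamma$ is ergodic on $K^{\mathcal{N}}$, then there is $\alpha\in\Gamma$ such that the dual action of $\alpha$ is ergodic on $K^{\mathcal{N}}$; (3) if $\Gamma=\{\alpha_{\mathbf{n}}\mid\mathbf{n}\in\mathbb{Z}^d\}$ and the dual action of $\Gamma$ is ergodic on $K^{\mathcal{N}}$,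 then there is $\mathbf{n}\in\mathbb{Z}^d$ such that the dual action of $\alpha_{\mathbf{n}}$ is ergodic on $K^{\mathcal{N}}$.
   Context: For an automorphism $\alpha$ of a discrete abelian group $A$, its dual automorphism on the compact abelian group $\hat A$ is $\chi\mapsto\chi\circ\alpha^{-1}$; this defines the dual action on $\hat A$. Let $K$ be a compact group with normalized Haar measure $\omega_K$. A group $\Gamma$ acting on $K$ by continuous automorphisms is ergodic on $K$ if every $\Gamma$-invariant Borel set $A\subset K$ satisfies $\omega_K(A)\in\{0,1\}$; an automorphism $\alpha$ is ergodic on $K$ if $\{\alpha^n\mid n\in\mathbb{Z}\}$ is. A group $H$ acting on $K$ by automorphisms has DCC on $K$ if for every decreasing sequence $(L_i)_{i\ge1}$ of $H$-invariant closed subgroups of $K$ there is $n\ge1$ with $L_n=L_{n+i}$ for all $i\ge0$. *)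

theory Defs
  imports
    "HOL-Analysis.Analysis"
    "HOL-Library.Poly_Mapping"
    "HOL-Algebra.Generated_Groups"
    "HOL-Algebra.Bij"
begin

section \<open>Laurent polynomials\<close>

text \<open>The Laurent polynomial ring in commuting variables indexed by the finite type \<open>'d\<close>: its
  elements are the finitely supported coefficient functions on the exponents \<open>\<int>\<^sup>d\<close>, and the
  multiplication of type \<open>poly_mapping\<close> is convolution, so this is the group ring of \<open>\<int>\<^sup>d\<close>.
  As every type is nonempty, \<open>CARD('d) \<ge> 1\<close>.\<close>

type_synonym ('d, 'f) laurent = "(int ^ 'd) \<Rightarrow>\<^sub>0 'f"

text \<open>The variable \<open>u\<^sub>i\<close> is \<open>laurent_monomial (axis i 1)\<close>; the two lemmas below say that
  \<open>laurent_monomial n\<close> is the product of the powers \<open>u\<^sub>i\<close> to the exponent \<open>n $ i\<close>.\<close>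

definition laurent_monomial :: "int ^ 'd::finite \<Rightarrow> ('d, 'f::field) laurent" where
  "laurent_monomial n = Poly_Mapping.single n 1"

definition laurent_const :: "'f::field \<Rightarrow> ('d::finite, 'f) laurent" where
  "laurent_const q = Poly_Mapping.single 0 q"

lemma laurent_monomial_0: "laurent_monomial 0 = 1"
  by (simp add: laurent_monomial_def)

lemma laurent_monomial_add:
  "laurent_monomial (m + n) = laurent_monomial m * laurent_monomial n"
  by (simp add: laurent_monomial_def mult_single)


section \<open>Automorphisms of a module\<close>

definition finitely_generated_module ::
    "('r::comm_ring_1 \<Rightarrow> 'n::ab_group_add \<Rightarrow> 'n) \<Rightarrow> bool" where
  "finitely_generated_module s \<longleftrightarrow>
     Modules.module s \<and> (\<exists>B. finite B \<and> module.span s B = UNIV)"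

definition module_aut_group ::
    "('r::comm_ring_1 \<Rightarrow> 'n::ab_group_add \<Rightarrow> 'n) \<Rightarrow> ('n \<Rightarrow> 'n) monoid" where
  "module_aut_group s = \<lparr>carrier = {f. bij f \<and> module_hom s s f}, mult = (\<circ>), one = id\<rparr>"

definition finitely_generated_subgroup :: "('a, 'b) monoid_scheme \<Rightarrow> 'a set \<Rightarrow> bool" where
  "finitely_generated_subgroup G H \<longleftrightarrow>
     subgroup H G \<and> (\<exists>S. finite S \<and> S \<subseteq> H \<and> generate G S = H)"

definition monomial_aut ::
    "(('d::finite, 'f::field) laurent \<Rightarrow> 'n::ab_group_add \<Rightarrow> 'n) \<Rightarrow> int ^ 'd \<Rightarrow> 'n \<Rightarrow> 'n" where
  "monomial_aut s n = (\<lambda>a. s (laurent_monomial n) a)"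

definition scaled_monomial_aut ::
    "(('d::finite, 'f::field) laurent \<Rightarrow> 'n::ab_group_add \<Rightarrow> 'n) \<Rightarrow> 'f \<Rightarrow> int ^ 'd \<Rightarrow> 'n \<Rightarrow> 'n" where
  "scaled_monomial_aut s q n = (\<lambda>a. s (laurent_const q) (monomial_aut s n a))"

lemma group_module_aut_group:
  assumes "Modules.module s"
  shows "group (module_aut_group s)"
proof (rule groupI)
  fix f assume "f \<in> carrier (module_aut_group s)"
  then have f: "bij f" "module_hom s s f" by (auto simp: module_aut_group_def)
  have "module_hom s s (inv_into UNIV f)"
    using assms f
    by (intro Modules.module_hom.intro module_hom_axioms.intro)
      (auto simp: bij_def inv_f_eq surj_f_inv_f module_hom.add module_hom.scale)
  with f show "\<exists>g\<in>carrier (module_aut_group s).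
      g \<otimes>\<^bsub>module_aut_group s\<^esub> f = \<one>\<^bsub>module_aut_group s\<^esub>"
    by (intro bexI[of _ "inv_into UNIV f"])
      (auto simp: module_aut_group_def bij_imp_bij_inv bij_is_inj)
qed (use assms in \<open>auto simp: module_aut_group_def bij_comp fun_eq_iff
       intro: module_hom_compose module.module_hom_id\<close>)


section \<open>The dual of a discrete abelian group\<close>

definition dual_group :: "('n::ab_group_add \<Rightarrow> complex) monoid" where
  "dual_group =
     \<lparr>carrier = {c. (\<forall>a. norm (c a) = 1) \<and> (\<forall>a b. c (a + b) = c a * c b)},
      mult = (\<lambda>c c' a. c a * c' a),
      one = (\<lambda>a. 1)\<rparr>"

text \<open>The function space carries the product topology (pointwise convergence), which on
  characters of a discrete group is the compact-open topology.\<close>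

definition dual_topology :: "('n::ab_group_add \<Rightarrow> complex) topology" where
  "dual_topology = top_of_set (carrier dual_group)"

text \<open>Restricted to the carrier, because the elements of \<^const>\<open>auto\<close> are extensional.\<close>

definition dual_aut ::
    "('n::ab_group_add \<Rightarrow> 'n) \<Rightarrow> ('n \<Rightarrow> complex) \<Rightarrow> ('n \<Rightarrow> complex)" where
  "dual_aut \<alpha> = (\<lambda>c\<in>carrier dual_group. c \<circ> inv_into UNIV \<alpha>)"

lemma comm_group_dual_group: "comm_group dual_group"
proof (rule comm_groupI)
  fix c :: "'a \<Rightarrow> complex" assume "c \<in> carrier dual_group"
  moreover from this have "c a \<noteq> 0" for a
    by (auto simp: dual_group_def dest: spec[of _ a])
  ultimately show "\<exists>c'\<in>carrier dual_group. c' \<otimes>\<^bsub>dual_group\<^esub> c = \<one>\<^bsub>dual_group\<^esub>"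
    by (intro bexI[of _ "\<lambda>a. inverse (c a)"])
      (auto simp: dual_group_def norm_inverse fun_eq_iff)
qed (auto simp: dual_group_def norm_mult)

lemma compact_space_dual_topology:
  "compact_space (dual_topology :: ('n::ab_group_add \<Rightarrow> complex) topology)"
proof -
  let ?T = "PiE UNIV (\<lambda>_. sphere 0 1) :: ('n \<Rightarrow> complex) set"
  have "compact ?T"
    using compactin_PiE[of "\<lambda>_::'n. euclidean :: complex topology" UNIV "\<lambda>_. sphere 0 1"]
    by (simp add: euclidean_product_topology)
  moreover have "closed {c :: 'n \<Rightarrow> complex. \<forall>a b. c (a + b) = c a * c b}"
    by (intro closed_Collect_all closed_Collect_eq continuous_intros continuous_on_product_coordinates)
  ultimately have "compact (?T \<inter> {c. \<forall>a b. c (a + b) = c a * c b})"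
    by (rule compact_Int_closed)
  moreover have "?T \<inter> {c. \<forall>a b. c (a + b) = c a * c b} = carrier dual_group"
    by (auto simp: dual_group_def PiE_UNIV_domain)
  ultimately show ?thesis
    by (simp add: dual_topology_def compact_space_subtopology)
qed

lemma dual_aut_in_auto:
  assumes "bij \<alpha>" "\<And>a b. \<alpha> (a + b) = \<alpha> a + \<alpha> b"
  shows "dual_aut \<alpha> \<in> auto dual_group"
proof -
  have add: "inv_into UNIV \<alpha> (a + b) = inv_into UNIV \<alpha> a + inv_into UNIV \<alpha> b" for a b
    using assms by (metis bij_inv_eq_iff)
  have "bij_betw (dual_aut \<alpha>) (carrier dual_group) (carrier dual_group)"
    by (rule bij_betw_byWitness[where f' = "\<lambda>c. c \<circ> \<alpha>"])
      (use assms add in \<open>auto simp: dual_aut_def dual_group_def fun_eq_iff bij_def surj_f_inv_f\<close>)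
  then show ?thesis
    by (auto simp: auto_def Bij_def hom_def dual_aut_def dual_group_def add norm_mult)
qed


section \<open>Ergodicity and the descending chain condition\<close>

text \<open>A compact group is given by a group \<open>G\<close> and a topology \<open>T\<close> on its carrier.
  The last condition is the regularity required of a Haar measure; for finite Borel measures on
  metrizable compact spaces it holds automatically.\<close>

definition normalized_haar_measure ::
    "('k, 'b) monoid_scheme \<Rightarrow> 'k topology \<Rightarrow> 'k measure \<Rightarrow> bool" where
  "normalized_haar_measure G T \<omega> \<longleftrightarrow>
     space \<omega> = carrier G \<and>
     sets \<omega> = sigma_sets (carrier G) {U. openin T U} \<and>
     emeasure \<omega> (carrier G) = 1 \<and>
     (\<forall>g\<in>carrier G. \<forall>A\<in>sets \<omega>. emeasure \<omega> (g <#\<^bsub>G\<^esub> A) = emeasure \<omega> A) \<and>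
     (\<forall>A\<in>sets \<omega>. emeasure \<omega> A = (SUP C\<in>{C. compactin T C \<and> closedin T C \<and> C \<subseteq> A}. emeasure \<omega> C))"

text \<open>An action by automorphisms of \<open>G\<close> enters the following notions only through the set
  \<open>H \<subseteq> auto G\<close> of automorphisms by which the group acts.\<close>

definition ergodic_action :: "'k measure \<Rightarrow> ('k \<Rightarrow> 'k) set \<Rightarrow> bool" where
  "ergodic_action \<omega> H \<longleftrightarrow>
     (\<forall>A\<in>sets \<omega>. (\<forall>h\<in>H. h ` A = A) \<longrightarrow> measure \<omega> A \<in> {0, 1})"

definition ergodic_automorphism ::
    "('k, 'b) monoid_scheme \<Rightarrow> 'k measure \<Rightarrow> ('k \<Rightarrow> 'k) \<Rightarrow> bool" where
  "ergodic_automorphism G \<omega> \<beta> \<longleftrightarrow>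
     ergodic_action \<omega> {\<beta> [^]\<^bsub>AutoGroup G\<^esub> n | n :: int. True}"

definition DCC_on ::
    "('k, 'b) monoid_scheme \<Rightarrow> 'k topology \<Rightarrow> ('k \<Rightarrow> 'k) set \<Rightarrow> bool" where
  "DCC_on G T H \<longleftrightarrow>
     (\<forall>L :: nat \<Rightarrow> 'k set.
        (\<forall>i. subgroup (L i) G \<and> closedin T (L i) \<and> (\<forall>h\<in>H. h ` L i = L i)) \<and>
        (\<forall>i. L (Suc i) \<subseteq> L i)
        \<longrightarrow> (\<exists>n. \<forall>i. L n = L (n + i)))"

end

theory Submission
  imports Defs
begin

text \<open>By duality a decreasing chain of \<open>\<Delta>\<close>-invariant closed subgroups is an increasing chain of
  submodules of \<open>\<N>\<close>, and \<open>\<N>\<close> is Noetherian by Hilbert's basis theorem; this gives (1).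

  A group of automorphisms acts ergodically on the dual iff no nonzero element of \<open>\<N>\<close> has a finite
  orbit, so (2) and (3) ask for a single element of \<open>\<Gamma>\<close> without nonzero periodic points. If \<open>g\<close> and
  \<open>h\<close> have no nonzero common periodic point, then the submodules of periodic points of \<open>g h\<^sup>m\<close>, for
  \<open>m = 0, 1, \<dots>\<close>, are independent, because an element which is periodic for two of these maps
  is periodic for both \<open>g\<close> and \<open>h\<close>. As \<open>\<N>\<close> is Noetherian, one of them vanishes. Induction over the
  generators of \<open>\<Gamma>\<close> does the rest, since the generators of an ergodic abelian group have no nonzero
  common periodic point.\<close>

section \<open>Noetherian rings\<close>

text \<open>The dual is handled by Fourier analysis on trigonometric polynomials, because
  \<open>normalized_haar_measure\<close> supplies translation invariance and regularity but no
  invariance under automorphisms. Characters separate points, so translation invariance forces the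
  integral of evaluation at \<open>a\<close> to vanish unless \<open>a = 0\<close>. This formula
  settles all questions for trigonometric polynomials; Stone-Weierstrass and inner regularity carry
  the answers to Borel sets. The two halves of the ergodicity criterion have different mechanisms. A
  finite invariant set avoiding 0 yields an invariant sum of evaluations with mean zero but a
  nonzero Fourier coefficient, which contradicts ergodicity. Absence of periodic points yields
  mixing: correlations of trigonometric polynomials factorise exactly from some power on. The
  duality behind (1) requires that a closed subgroup be recovered from its annihilator. In place of
  integration over the subgroup, averages over finite products of its elements damp the evaluations
  that are nontrivial on it.\<close>

inductive_set ideal_span :: "'r::comm_ring_1 set \<Rightarrow> 'r set \<Rightarrow> 'r set" for B F where
  zero: "0 \<in> ideal_span B F"
| step: "c \<in> B \<Longrightarrow> f \<in> F \<Longrightarrow> y \<in> ideal_span B F \<Longrightarrow> c * f + y \<in> ideal_span B F"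

definition is_subring :: "'r::comm_ring_1 set \<Rightarrow> bool" where
  "is_subring B \<longleftrightarrow> 0 \<in> B \<and> 1 \<in> B \<and> (\<forall>x\<in>B. \<forall>y\<in>B. x + y \<in> B \<and> x * y \<in> B \<and> - x \<in> B)"

text \<open>A sequential form of the ascending chain condition. Rings are subsets of a fixed type
  because generators are adjoined one at a time in an induction, during which the type cannot
  change.\<close>

definition noetherian_subring :: "'r::comm_ring_1 set \<Rightarrow> bool" where
  "noetherian_subring B \<longleftrightarrow> is_subring B \<and>
     (\<forall>x :: nat \<Rightarrow> 'r. range x \<subseteq> B \<longrightarrow> (\<exists>m. x m \<in> ideal_span B (x ` {..<m})))"

lemma ideal_span_add:
  assumes "x \<in> ideal_span B F" "y \<in> ideal_span B F"
  shows "x + y \<in> ideal_span B F"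
  using assms(1) by induction (auto simp: assms(2) add.assoc intro: ideal_span.step)

lemma ideal_span_scale:
  assumes "is_subring B" "c \<in> B" "x \<in> ideal_span B F"
  shows "c * x \<in> ideal_span B F"
  using assms(3)
proof induction
  case zero
  then show ?case by (simp add: ideal_span.zero)
next
  case (step d f y)
  have "c * (d * f + y) = (c * d) * f + c * y" by (simp add: algebra_simps)
  with step show ?case using assms(1,2) by (auto simp: is_subring_def intro: ideal_span.step)
qed

lemma ideal_span_uminus:
  assumes "is_subring B" "x \<in> ideal_span B F"
  shows "- x \<in> ideal_span B F"
  using ideal_span_scale[OF assms(1) _ assms(2), of "- 1"] assms(1) by (auto simp: is_subring_def)

lemma ideal_span_diff:
  assumes "is_subring B" "x \<in> ideal_span B F" "y \<in> ideal_span B F"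
  shows "x - y \<in> ideal_span B F"
  using ideal_span_add[OF assms(2) ideal_span_uminus[OF assms(1,3)]] by simp

lemma ideal_span_base:
  assumes "is_subring B" "f \<in> F" shows "f \<in> ideal_span B F"
  using ideal_span.step[of 1 B f F 0] assms by (auto simp: is_subring_def intro: ideal_span.zero)

lemma ideal_span_minimal:
  assumes "is_subring B" "F \<subseteq> ideal_span B G"
  shows "ideal_span B F \<subseteq> ideal_span B G"
proof
  fix x assume "x \<in> ideal_span B F"
  then show "x \<in> ideal_span B G"
    by induction (use assms in \<open>auto intro!: ideal_span.zero ideal_span_add ideal_span_scale\<close>)
qed

lemma ideal_span_subset:
  assumes "is_subring B" "F \<subseteq> B" shows "ideal_span B F \<subseteq> B"
proof
  fix x assume "x \<in> ideal_span B F"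
  then show "x \<in> B" by induction (use assms in \<open>auto simp: is_subring_def\<close>)
qed

lemma ideal_span_mono: "F \<subseteq> G \<Longrightarrow> x \<in> ideal_span B F \<Longrightarrow> x \<in> ideal_span B G"
  by (rotate_tac, induction rule: ideal_span.induct) (auto intro: ideal_span.intros)

section \<open>Hilbert's basis theorem\<close>

definition poly_over :: "'r::comm_ring_1 set \<Rightarrow> 'r poly set" where
  "poly_over A = {p. \<forall>i. coeff p i \<in> A}"

lemma sum_in_subring:
  assumes "is_subring A" "\<And>i. i \<in> I \<Longrightarrow> f i \<in> A" shows "sum f I \<in> A"
  using assms(2) by (induction I rule: infinite_finite_induct)
    (use assms(1) in \<open>auto simp: is_subring_def\<close>)

lemma is_subring_poly_over:
  assumes "is_subring A" shows "is_subring (poly_over A)"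
  using assms unfolding is_subring_def[of "poly_over A"] poly_over_def
  by (auto simp: coeff_mult is_subring_def coeff_1 intro!: sum_in_subring[OF assms])

lemma monom_in_poly_over: "is_subring A \<Longrightarrow> c \<in> A \<Longrightarrow> monom c n \<in> poly_over A"
  by (auto simp: poly_over_def is_subring_def)

text \<open>Raising the degrees of the \<open>f i\<close> to a common \<open>D\<close> transports linear relations between leading
  coefficients to polynomials.\<close>

lemma lift_leading_coeff:
  assumes A: "is_subring A" and f: "\<And>i. i < m \<Longrightarrow> degree (f i) \<le> D"
    and b: "b \<in> ideal_span A ((\<lambda>i. lead_coeff (f i)) ` {..<m})"
  shows "\<exists>g\<in>ideal_span (poly_over A) (f ` {..<m}). degree g \<le> D \<and> coeff g D = b"
  using b
proof induction
  case zero
  then show ?case by (intro bexI[of _ 0]) (auto intro: ideal_span.zero)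
next
  case (step c a y)
  then obtain g i where g: "g \<in> ideal_span (poly_over A) (f ` {..<m})" "degree g \<le> D" "coeff g D = y"
    and i: "i < m" "a = lead_coeff (f i)" by auto
  let ?g = "monom c (D - degree (f i)) * f i + g"
  have "?g \<in> ideal_span (poly_over A) (f ` {..<m})"
    using step(1) i g A by (intro ideal_span.step monom_in_poly_over) auto
  moreover have "degree ?g \<le> D"
  proof (rule degree_add_le)
    have "degree (monom c (D - degree (f i)) * f i) \<le> (D - degree (f i)) + degree (f i)"
      by (rule order_trans[OF degree_mult_le]) (simp add: degree_monom_le)
    with f[OF i(1)] show "degree (monom c (D - degree (f i)) * f i) \<le> D" by simp
  qed fact
  moreover have "coeff ?g D = c * a + y"
    using f[OF i(1)] i(2) g(3) by (simp add: coeff_monom_mult)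
  ultimately show ?case by blast
qed

text \<open>Each element of the ideal involves only finitely many terms of \<open>x\<close>. Hence,
  if no \<open>x m\<close> lies in the ideal of its predecessors, finitely many elements cannot
  generate the whole ideal.\<close>

lemma finite_ideal_span_bound:
  fixes x :: "nat \<Rightarrow> 'r::comm_ring_1"
  assumes "finite G" "G \<subseteq> ideal_span B (range x)"
  shows "\<exists>k. G \<subseteq> ideal_span B (x ` {..<k})"
proof -
  have one: "\<exists>k. g \<in> ideal_span B (x ` {..<k})" if "g \<in> ideal_span B (range x)" for g
    using that
  proof induction
    case zero
    then show ?case by (auto intro: ideal_span.zero)
  next
    case (step c f y)
    then obtain k i where ki: "y \<in> ideal_span B (x ` {..<k})" "f = x i" by auto
    then have "y \<in> ideal_span B (x ` {..<max k (Suc i)})" by (elim ideal_span_mono[rotated]) auto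
    with step(1) ki have "c * f + y \<in> ideal_span B (x ` {..<max k (Suc i)})"
      by (intro ideal_span.step) auto
    then show ?case by blast
  qed
  show ?thesis using assms
  proof (induction rule: finite_induct)
    case (insert g G)
    then obtain k k' where "G \<subseteq> ideal_span B (x ` {..<k})" "g \<in> ideal_span B (x ` {..<k'})"
      using one[of g] by auto
    then have "insert g G \<subseteq> ideal_span B (x ` {..<max k k'})"
      by (auto intro: ideal_span_mono[rotated])
    then show ?case by blast
  qed auto
qed

text \<open>A bad sequence \<open>x\<close> spans an ideal \<open>I\<close> without finite
  generating set, so \<open>f m\<close> can be chosen of least degree in \<open>I\<close> outside
  the ideal of the earlier \<open>f i\<close>. A relation between leading coefficients lifts to some
  \<open>g\<close> in that ideal with the same top coefficient as \<open>f m\<close>, and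
  \<open>f m - g\<close> contradicts minimality.\<close>

theorem hilbert_basis:
  fixes A :: "'r::comm_ring_1 set"
  assumes "noetherian_subring A" shows "noetherian_subring (poly_over A)"
proof -
  let ?P = "poly_over A"
  have A: "is_subring A" and P: "is_subring ?P"
    using assms by (auto simp: noetherian_subring_def is_subring_poly_over)
  have "\<exists>m. x m \<in> ideal_span ?P (x ` {..<m})" if x: "range x \<subseteq> ?P" for x :: "nat \<Rightarrow> 'r poly"
  proof (rule ccontr)
    assume no: "\<not> ?thesis"
    define I where "I = ideal_span ?P (range x)"
    have IP: "I \<subseteq> ?P" unfolding I_def by (rule ideal_span_subset[OF P x])
    define Q where "Q f m g \<longleftrightarrow> g \<in> I - ideal_span ?P (f ` {..<m}) \<and>
      (\<forall>h \<in> I - ideal_span ?P (f ` {..<m}). degree g \<le> degree h)" for f and m :: nat and g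
    \<comment> \<open>The recursive choice requires \<open>Q f m\<close> to depend on
      \<open>f\<close> only through its values below \<open>m\<close>.\<close>
    have "\<exists>f. \<forall>m. Q f m (f m)"
    proof (rule dependent_wellorder_choice)
      fix g :: "'r poly" and f f' :: "nat \<Rightarrow> 'r poly" and m :: nat
      assume "\<And>y. y < m \<Longrightarrow> f y = f' y"
      then have "f ` {..<m} = f' ` {..<m}" by auto
      then show "Q f m g = Q f' m g" by (simp add: Q_def)
    next
      fix f :: "nat \<Rightarrow> 'r poly" and m :: nat
      assume *: "\<And>y. y < m \<Longrightarrow> Q f y (f y)"
      have "f ` {..<m} \<subseteq> ideal_span ?P (range x)" using * by (auto simp: Q_def I_def)
      then obtain k where k: "f ` {..<m} \<subseteq> ideal_span ?P (x ` {..<k})"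
        using finite_ideal_span_bound[of "f ` {..<m}" ?P x] by auto
      have "x k \<notin> ideal_span ?P (f ` {..<m})" using no ideal_span_minimal[OF P k] by auto
      moreover have "x k \<in> I" unfolding I_def by (rule ideal_span_base[OF P]) simp
      ultimately have ex: "x k \<in> I - ideal_span ?P (f ` {..<m})" by simp
      show "\<exists>g. Q f m g"
        using ex_has_least_nat[of "\<lambda>g. g \<in> I - ideal_span ?P (f ` {..<m})" "x k" degree, OF ex]
        unfolding Q_def by auto
    qed
    then obtain f where f: "\<And>m. Q f m (f m)" by blast
    then have fI: "f m \<in> I" and fn: "f m \<notin> ideal_span ?P (f ` {..<m})" for m
      by (auto simp: Q_def)
    have "range (\<lambda>i. lead_coeff (f i)) \<subseteq> A"
      using fI IP by (auto simp: poly_over_def)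
    then obtain m where m: "lead_coeff (f m) \<in> ideal_span A ((\<lambda>i. lead_coeff (f i)) ` {..<m})"
      using assms unfolding noetherian_subring_def by blast
    have le: "degree (f i) \<le> degree (f m)" if "i < m" for i
    proof -
      have "ideal_span ?P (f ` {..<i}) \<subseteq> ideal_span ?P (f ` {..<m})"
        using that by (auto intro: ideal_span_mono[rotated])
      with fI[of m] fn[of m] f[of i] show ?thesis by (auto simp: Q_def)
    qed
    obtain g where g: "g \<in> ideal_span ?P (f ` {..<m})" "degree g \<le> degree (f m)"
      "coeff g (degree (f m)) = lead_coeff (f m)"
      using lift_leading_coeff[OF A le m] by blast
    have "ideal_span ?P (f ` {..<m}) \<subseteq> I"
      unfolding I_def using fI by (intro ideal_span_minimal[OF P]) (auto simp: I_def)
    with g fI have "f m - g \<in> I" unfolding I_def by (intro ideal_span_diff[OF P]) auto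
    moreover have dn: "f m - g \<notin> ideal_span ?P (f ` {..<m})"
      using ideal_span_add[OF _ g(1), of "f m - g"] fn[of m] by auto
    ultimately have "degree (f m) \<le> degree (f m - g)" using f[of m] by (auto simp: Q_def)
    moreover have "degree (f m - g) \<le> degree (f m)" using g(2) by (intro degree_diff_le) auto
    ultimately have "degree (f m - g) = degree (f m)" by simp
    \<comment> \<open>Equality of degrees makes the cancelled top coefficient the leading one, so
      the difference is 0, which lies in every ideal.\<close>
    then have "lead_coeff (f m - g) = 0" using g(3) by simp
    then have "f m - g = 0" by (simp only: leading_coeff_0_iff)
    then show False using dn by (auto simp: ideal_span.zero)
  qed
  with P show ?thesis by (simp add: noetherian_subring_def)
qed

lemma noetherian_subring_image:
  fixes h :: "'r::comm_ring_1 \<Rightarrow> 's::comm_ring_1"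
  assumes B: "noetherian_subring B"
    and h: "h 0 = 0" "h 1 = 1" "\<And>x y. h (x + y) = h x + h y" "\<And>x y. h (x * y) = h x * h y"
  shows "noetherian_subring (h ` B)"
proof -
  have neg: "h (- x) = - h x" for x using h(1) h(3)[of x "- x"] by (simp add: eq_neg_iff_add_eq_0 add.commute)
  have R: "is_subring (h ` B)"
    using B unfolding noetherian_subring_def is_subring_def
    by (auto simp flip: h neg intro!: imageI)
  have "\<exists>m. x m \<in> ideal_span (h ` B) (x ` {..<m})" if x: "range x \<subseteq> h ` B" for x :: "nat \<Rightarrow> 's"
  proof -
    have "\<forall>i. \<exists>y\<in>B. x i = h y" using x by (auto simp: image_iff subset_iff)
    then obtain y where y: "\<And>i. y i \<in> B" "\<And>i. x i = h (y i)" by metis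
    have "range y \<subseteq> B" using y(1) by auto
    then obtain m where "y m \<in> ideal_span B (y ` {..<m})"
      using B unfolding noetherian_subring_def by blast
    then have "h (y m) \<in> ideal_span (h ` B) (x ` {..<m})"
      by induction (auto simp: h y(2) intro!: ideal_span.intros)
    then show ?thesis using y(2) by metis
  qed
  with R show ?thesis by (simp add: noetherian_subring_def)
qed

text \<open>The ring generated by \<open>x\<close> over \<open>A\<close> is the image of
  \<open>poly_over A\<close> under evaluation at \<open>x\<close>.\<close>

lemma noetherian_adjoin:
  fixes A :: "'r::comm_ring_1 set"
  assumes "noetherian_subring A"
  shows "\<exists>B. noetherian_subring B \<and> insert x A \<subseteq> B"
proof (intro exI conjI)
  show "noetherian_subring ((\<lambda>p. poly p x) ` poly_over A)"
    by (rule noetherian_subring_image[OF hilbert_basis[OF assms]]) auto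
  have A: "is_subring A" using assms by (simp add: noetherian_subring_def)
  have "a \<in> (\<lambda>p. poly p x) ` poly_over A" if "a \<in> A" for a
    using monom_in_poly_over[OF A that, of 0] by (auto simp: image_iff poly_monom intro!: bexI[of _ "monom a 0"])
  moreover have "x \<in> (\<lambda>p. poly p x) ` poly_over A"
    using monom_in_poly_over[OF A, of 1 1] A
    by (auto simp: image_iff poly_monom is_subring_def intro!: bexI[of _ "monom 1 1"])
  ultimately show "insert x A \<subseteq> (\<lambda>p. poly p x) ` poly_over A" by blast
qed

lemma noetherian_adjoin_finite:
  fixes A :: "'r::comm_ring_1 set"
  assumes "finite X" "noetherian_subring A"
  shows "\<exists>B. noetherian_subring B \<and> X \<union> A \<subseteq> B"
  using assms
proof (induction rule: finite_induct)
  case (insert x X)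
  then obtain B where "noetherian_subring B" "X \<union> A \<subseteq> B" by auto
  with noetherian_adjoin[of B x] show ?case by auto
qed auto

section \<open>The ring of Laurent polynomials\<close>

lemma noetherian_laurent_const:
  "noetherian_subring (range (laurent_const :: 'f::field \<Rightarrow> ('d::finite, 'f) laurent))"
proof -
  let ?C = "range (laurent_const :: 'f \<Rightarrow> ('d, 'f) laurent)"
  have R: "is_subring ?C"
    unfolding is_subring_def laurent_const_def
    by (auto simp: mult_single simp flip: single_add single_uminus single_one)
      (metis rangeI single_zero)
  have "\<exists>m. x m \<in> ideal_span ?C (x ` {..<m})" if x: "range x \<subseteq> ?C" for x :: "nat \<Rightarrow> ('d, 'f) laurent"
  proof (cases "x 0 = 0")
    case True
    then show ?thesis by (intro exI[of _ 0]) (simp add: ideal_span.zero)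
  next
    case False
    obtain p q where pq: "x 0 = laurent_const p" "x 1 = laurent_const q" using x by (metis rangeE rangeI subsetD)
    with False have "p \<noteq> 0" by (auto simp: laurent_const_def)
    \<comment> \<open>In a field the nonzero \<open>x 0\<close> divides \<open>x 1\<close>, so
      \<open>m = 1\<close> works.\<close>
    then have "x 1 = laurent_const (q / p) * x 0 + 0"
      unfolding pq by (simp add: laurent_const_def mult_single)
    also have "\<dots> \<in> ideal_span ?C (x ` {..<1})"
      by (intro ideal_span.intros) auto
    finally show ?thesis by blast
  qed
  with R show ?thesis by (simp add: noetherian_subring_def)
qed

lemma axis_0: "axis i 0 = 0"
  by (simp add: vec_eq_iff axis_def)

lemma laurent_monomial_power: "laurent_monomial (axis i (int k)) = laurent_monomial (axis i 1) ^ k"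
proof (induction k)
  case 0
  show ?case by (simp add: axis_0 laurent_monomial_0)
next
  case (Suc k)
  have "axis i (int (Suc k)) = axis i 1 + axis i (int k)" by (auto simp: vec_eq_iff axis_def)
  then show ?case using Suc by (simp add: laurent_monomial_add)
qed

lemma laurent_monomial_power_neg: "laurent_monomial (axis i (- int k)) = laurent_monomial (axis i (- 1)) ^ k"
proof (induction k)
  case 0
  show ?case by (simp add: axis_0 laurent_monomial_0)
next
  case (Suc k)
  have "axis i (- int (Suc k)) = axis i (- 1) + axis i (- int k)" by (auto simp: vec_eq_iff axis_def)
  then show ?case using Suc by (simp add: laurent_monomial_add)
qed

lemma laurent_monomial_sum: "finite I \<Longrightarrow> laurent_monomial (sum f I) = (\<Prod>i\<in>I. laurent_monomial (f i))"
  by (induction rule: finite_induct) (auto simp: laurent_monomial_0 laurent_monomial_add)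

lemma vec_eq_sum_axis: "n = (\<Sum>i\<in>UNIV. axis i (n $ i))" for n :: "int ^ 'd::finite"
  by (simp add: vec_eq_iff axis_def if_distrib cong: if_cong)

lemma is_subring_power: "is_subring B \<Longrightarrow> x \<in> B \<Longrightarrow> x ^ k \<in> B"
  by (induction k) (auto simp: is_subring_def)

lemma is_subring_prod:
  "is_subring B \<Longrightarrow> finite I \<Longrightarrow> (\<And>i. i \<in> I \<Longrightarrow> f i \<in> B) \<Longrightarrow> prod f I \<in> B"
  by (rotate_tac, induction I rule: finite_induct) (auto simp: is_subring_def)

text \<open>The terms with \<open>c\<close> nonzero are exactly the scalars by which \<Delta> acts;
  in \<open>DCC_scaled_monomials\<close> this turns \<Delta>-invariance into closure under all
  scalars.\<close>

lemma laurent_induct: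
  fixes p :: "('d::finite, 'f::field) laurent"
  assumes "P 0" "\<And>p q. P p \<Longrightarrow> P q \<Longrightarrow> P (p + q)"
    and "\<And>c n. P (laurent_const c * laurent_monomial n)"
  shows "P p"
proof (induction p rule: update_induct)
  case const
  then show ?case by (metis assms(1))
next
  case (update f a b)
  have "Poly_Mapping.update a b f = f + laurent_const b * laurent_monomial a"
    using update(1) by (intro poly_mapping_eqI)
      (auto simp: lookup_add lookup_update laurent_const_def laurent_monomial_def mult_single
        lookup_single when_def in_keys_iff)
  with update assms show ?case by metis
qed

text \<open>The variables and their inverses generate the ring over the constants; both are adjoined
  because ring generation only provides natural powers.\<close>

theorem noetherian_laurent: "noetherian_subring (UNIV :: ('d::finite, 'f::field) laurent set)"
proof -
  define X where "X = range (\<lambda>i. laurent_monomial (axis i 1)) \<union>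
    range (\<lambda>i. laurent_monomial (axis i (- 1)) :: ('d, 'f) laurent)"
  have "finite X" by (simp add: X_def)
  from noetherian_adjoin_finite[OF this noetherian_laurent_const]
  obtain B where B: "noetherian_subring B" "X \<subseteq> B" "range laurent_const \<subseteq> B" by auto
  then have R: "is_subring B" by (simp add: noetherian_subring_def)
  have ax: "laurent_monomial (axis i k) \<in> B" for i k
  proof (cases k)
    case (nonneg m)
    with B(2) show ?thesis
      by (auto simp: laurent_monomial_power X_def intro!: is_subring_power[OF R])
  next
    case (neg m)
    have "laurent_monomial (axis i (- int (Suc m))) \<in> B" unfolding laurent_monomial_power_neg
      by (rule is_subring_power[OF R]) (use B(2) in \<open>auto simp: X_def\<close>)
    with neg show ?thesis by simp
  qed
  have "laurent_monomial n \<in> B" for n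
    by (subst vec_eq_sum_axis, subst laurent_monomial_sum) (auto intro!: is_subring_prod[OF R] ax)
  moreover have "laurent_const c \<in> B" for c using B(3) by auto
  ultimately have "p \<in> B" for p
    by (induction p rule: laurent_induct) (use R in \<open>auto simp: is_subring_def\<close>)
  then have "B = UNIV" by blast
  with B show ?thesis by simp
qed


section \<open>Noetherian modules and periodic points\<close>

text \<open>If the chain never stabilised, every \<open>I n\<close> would be followed by some
  \<open>I (g n)\<close> with a new element \<open>y n\<close>. Along the iterates
  \<open>k j\<close> of \<open>g\<close>, the predecessors of \<open>x m\<close> all lie in the
  ideal \<open>I (k m)\<close>, which omits \<open>x m\<close>.\<close>

lemma noetherian_ideal_chain:
  fixes I :: "nat \<Rightarrow> 'r::comm_ring_1 set"
  assumes noeth: "noetherian_subring (UNIV :: 'r set)"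
    and I: "\<And>i. 0 \<in> I i" "\<And>i x y. x \<in> I i \<Longrightarrow> y \<in> I i \<Longrightarrow> x + y \<in> I i"
      "\<And>i c x. x \<in> I i \<Longrightarrow> c * x \<in> I i"
    and mono: "\<And>i j. i \<le> j \<Longrightarrow> I i \<subseteq> I j"
  shows "\<exists>n. \<forall>i. I (n + i) = I n"
proof (rule ccontr)
  assume no: "\<not> ?thesis"
  have "\<forall>n. \<exists>k x. n < k \<and> x \<in> I k - I n"
  proof
    fix n
    from no obtain i where "I (n + i) \<noteq> I n" by blast
    moreover have "I n \<subseteq> I (n + i)" by (rule mono) simp
    ultimately obtain x where x: "x \<in> I (n + i)" "x \<notin> I n" by blast
    then have "i \<noteq> 0" by (metis add_0_right)
    with x show "\<exists>k x. n < k \<and> x \<in> I k - I n" by (intro exI[of _ "n + i"] exI[of _ x]) auto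
  qed
  then obtain g y where gy: "\<And>n. n < g n" "\<And>n. y n \<in> I (g n) - I n" by metis
  define k where "k j = (g ^^ j) 0" for j
  define x where "x j = y (k j)" for j
  have k_Suc: "k (Suc j) = g (k j)" for j by (simp add: k_def)
  have "strict_mono k" by (rule strict_monoI_Suc) (simp add: k_Suc gy)
  then have kmono: "k i \<le> k j" if "i \<le> j" for i j using that by (simp add: strict_mono_less_eq)
  obtain m where m: "x m \<in> ideal_span UNIV (x ` {..<m})"
    using noeth unfolding noetherian_subring_def by blast
  have "x ` {..<m} \<subseteq> I (k m)"
  proof
    fix z assume "z \<in> x ` {..<m}"
    then obtain j where j: "j < m" "z = x j" by auto
    have "x j \<in> I (k (Suc j))" using gy(2) by (simp add: x_def k_Suc)
    moreover have "I (k (Suc j)) \<subseteq> I (k m)" using j by (intro mono kmono) simp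
    ultimately show "z \<in> I (k m)" using j by blast
  qed
  moreover have "ideal_span UNIV F \<subseteq> I i" if F: "F \<subseteq> I i" for F i
  proof
    fix z assume "z \<in> ideal_span UNIV F"
    then show "z \<in> I i" by induction (use I F in auto)
  qed
  ultimately have "x m \<in> I (k m)" using m by blast
  then show False using gy(2) by (simp add: x_def)
qed

text \<open>Within \<open>span (insert b B)\<close>, a member of an increasing chain is controlled
  by the ideal of its \<open>b\<close>-coefficients and its intersection with \<open>span B\<close>.
  Once both are stable, the chain is.\<close>

lemma (in module) span_chain_stabilizes:
  assumes noeth: "noetherian_subring (UNIV :: 'a set)" and "finite B"
    and "\<And>i. subspace (L i)" "\<And>i. L i \<subseteq> span B" "\<And>i j :: nat. i \<le> j \<Longrightarrow> L i \<subseteq> L j"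
  shows "\<exists>n. \<forall>i. L (n + i) = L n"
  using assms(2-)
proof (induction B arbitrary: L rule: finite_induct)
  case empty
  then have "L i = {0}" for i using subspace_0 by (auto simp: subset_eq)
  then show ?case by simp
next
  case (insert b B)
  note L = insert.prems
  define I where "I i = {r. \<exists>v\<in>span B. r *s b + v \<in> L i}" for i
  have "\<exists>n. \<forall>i. I (n + i) = I n"
  proof (rule noetherian_ideal_chain[OF noeth])
    show "0 \<in> I i" for i
      using subspace_0[OF L(1)] span_zero by (auto simp: I_def intro!: bexI[of _ 0])
    show "x + y \<in> I i" if xy: "x \<in> I i" "y \<in> I i" for i x y
    proof -
      obtain v w where "v \<in> span B" "w \<in> span B" "x *s b + v \<in> L i" "y *s b + w \<in> L i"
        using xy by (auto simp: I_def)
      then have "v + w \<in> span B" "(x + y) *s b + (v + w) \<in> L i"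
        using subspace_add[OF L(1), of "x *s b + v" i "y *s b + w"] span_add[of v B w]
        by (simp_all add: scale_left_distrib ac_simps)
      then show ?thesis by (auto simp: I_def)
    qed
    show "c * x \<in> I i" if x: "x \<in> I i" for i c x
    proof -
      obtain v where "v \<in> span B" "x *s b + v \<in> L i" using x by (auto simp: I_def)
      then have "c *s v \<in> span B" "(c * x) *s b + c *s v \<in> L i"
        using subspace_scale[OF L(1), of "x *s b + v" i c] span_scale[of v B c]
        by (simp_all add: scale_right_distrib)
      then show ?thesis by (auto simp: I_def)
    qed
    show "I i \<subseteq> I j" if "i \<le> j" for i j using L(3)[OF that] by (auto simp: I_def)
  qed
  then obtain n1 where n1: "\<And>i. I (n1 + i) = I n1" by blast
  have "\<exists>n. \<forall>i. L (n + i) \<inter> span B = L n \<inter> span B"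
    using L by (intro insert.IH Int_mono) (auto intro!: subspace_inter)
  then obtain n2 where "\<forall>i. L (n2 + i) \<inter> span B = L n2 \<inter> span B" by (rule exE)
  then have n2: "L (n2 + i) \<inter> span B = L n2 \<inter> span B" for i by (rule spec)
  define n where "n = max n1 n2"
  have nI: "I (n + i) = I n" for i
    using n1[of "n - n1 + i"] n1[of "n - n1"] by (simp add: n_def)
  have nL: "L (n + i) \<inter> span B = L n \<inter> span B" for i
    using n2[of "n - n2 + i"] n2[of "n - n2"] by (simp add: n_def)
  have "L (n + i) \<subseteq> L n" for i
  proof
    fix x assume x: "x \<in> L (n + i)"
    then obtain r where r: "x - r *s b \<in> span B" using L(2)[of "n + i"] by (auto simp: span_insert)
    with x have "r \<in> I (n + i)" by (auto simp: I_def intro!: bexI[of _ "x - r *s b"])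
    then have "r \<in> I n" by (simp only: nI)
    \<comment> \<open>An element of \<open>L n\<close> with the same \<open>b\<close>-coefficient as
      \<open>x\<close>; the difference lies in \<open>L (n + i)\<close> and in
      \<open>span B\<close>, hence in \<open>L n\<close>.\<close>
    then obtain v where v: "v \<in> span B" "r *s b + v \<in> L n" by (auto simp: I_def)
    have "x - (r *s b + v) \<in> L (n + i)"
      using x v L(3)[of n "n + i"] by (intro subspace_diff L(1)) auto
    moreover have "x - (r *s b + v) \<in> span B"
      using span_diff[OF r v(1)] by (simp add: algebra_simps)
    ultimately have "x - (r *s b + v) \<in> L n" using nL by blast
    from subspace_add[OF L(1) this v(2)] show "x \<in> L n" by simp
  qed
  moreover have "L n \<subseteq> L (n + i)" for i by (rule L) simp
  ultimately show ?case by blast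
qed

lemma (in module) noetherian_sequence:
  fixes x :: "nat \<Rightarrow> 'b"
  assumes "noetherian_subring (UNIV :: 'a set)" "finite B" "span B = UNIV"
  shows "\<exists>m. x m \<in> span (x ` {..<m})"
proof -
  have "\<exists>n. \<forall>i. span (x ` {..<n + i}) = span (x ` {..<n})"
    by (rule span_chain_stabilizes[OF assms(1,2)]) (auto simp: assms(3) intro!: span_mono)
  then obtain n where "span (x ` {..<n + 1}) = span (x ` {..<n})" by blast
  moreover have "x n \<in> span (x ` {..<n + 1})" by (rule span_base) simp
  ultimately show ?thesis by blast
qed

section \<open>Periodic points of commuting injective module maps\<close>

definition periodic_points :: "('a \<Rightarrow> 'a) \<Rightarrow> 'a set" where
  "periodic_points g = {a. \<exists>n>0. (g ^^ n) a = a}"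

lemma funpow_fixed_mult: "(g ^^ n) a = a \<Longrightarrow> (g ^^ (n * k)) a = a"
  by (induction k) (auto simp: funpow_add)

lemma funpow_comp_commute:
  assumes "f \<circ> g = g \<circ> f" shows "(f \<circ> g) ^^ n = f ^^ n \<circ> g ^^ n"
proof (induction n)
  case (Suc n)
  have "g ((f ^^ n) x) = (f ^^ n) (g x)" for x
    using assms by (induction n) (simp_all add: fun_eq_iff, metis)
  then have "f (g ((f ^^ n) ((g ^^ n) x))) = f ((f ^^ n) (g ((g ^^ n) x)))" for x
    by (auto simp: fun_eq_iff)
  with Suc show ?case by (auto simp: fun_eq_iff)
qed auto

text \<open>Periodicity involves forward powers only, so \<Gamma> appears as a commutative monoid of
  injections. Noetherianity takes the sequential form that \<open>aperiodic_member\<close>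
  consumes.\<close>

locale commuting_injections = module s
  for s :: "'r::comm_ring_1 \<Rightarrow> 'n::ab_group_add \<Rightarrow> 'n" +
  fixes \<Gamma> :: "('n \<Rightarrow> 'n) set"
  assumes noetherian: "\<And>x :: nat \<Rightarrow> 'n. \<exists>m. x m \<in> span (x ` {..<m})"
    and hom: "\<And>g. g \<in> \<Gamma> \<Longrightarrow> module_hom s s g"
    and inj: "\<And>g. g \<in> \<Gamma> \<Longrightarrow> inj g"
    and comm: "\<And>g h. g \<in> \<Gamma> \<Longrightarrow> h \<in> \<Gamma> \<Longrightarrow> g \<circ> h = h \<circ> g"
    and id_in: "id \<in> \<Gamma>"
    and comp_in: "\<And>g h. g \<in> \<Gamma> \<Longrightarrow> h \<in> \<Gamma> \<Longrightarrow> g \<circ> h \<in> \<Gamma>"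
begin

definition invariant_submodule :: "'n set \<Rightarrow> bool" where
  "invariant_submodule M \<longleftrightarrow> subspace M \<and> (\<forall>g\<in>\<Gamma>. g ` M \<subseteq> M)"

lemma funpow_in: "g \<in> \<Gamma> \<Longrightarrow> g ^^ n \<in> \<Gamma>"
  by (induction n) (auto simp: id_in comp_in simp flip: id_def)

lemma subspace_periodic:
  assumes "g \<in> \<Gamma>" shows "subspace (periodic_points g)"
proof (rule subspaceI)
  interpret g: module_hom s s "g ^^ n" for n by (rule hom[OF funpow_in[OF assms]])
  show "0 \<in> periodic_points g" by (auto simp: periodic_points_def g.zero intro!: exI[of _ 1])
  show "x + y \<in> periodic_points g" if xy: "x \<in> periodic_points g" "y \<in> periodic_points g" for x y
  proof -
    obtain m n where "m > 0" "n > 0" "(g ^^ m) x = x" "(g ^^ n) y = y"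
      using xy by (auto simp: periodic_points_def)
    then have "m * n > 0" "(g ^^ (m * n)) (x + y) = x + y"
      using funpow_fixed_mult[of m g x n] funpow_fixed_mult[of n g y m]
      by (auto simp: g.add mult.commute)
    then show ?thesis unfolding periodic_points_def by blast
  qed
  show "s c x \<in> periodic_points g" if "x \<in> periodic_points g" for c x
    using that by (auto simp: periodic_points_def g.scale)
qed

lemma invariant_periodic:
  assumes "g \<in> \<Gamma>" shows "invariant_submodule (periodic_points g)"
proof -
  have "h a \<in> periodic_points g" if "h \<in> \<Gamma>" and a: "a \<in> periodic_points g" for h a
  proof -
    obtain n where "n > 0" "(g ^^ n) a = a" using a by (auto simp: periodic_points_def)
    with comm[OF that(1) funpow_in[OF assms, of n]] show ?thesis
      by (auto simp: periodic_points_def fun_eq_iff) metis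
  qed
  then show ?thesis using subspace_periodic[OF assms] by (auto simp: invariant_submodule_def)
qed

lemma invariant_Int:
  "invariant_submodule M \<Longrightarrow> invariant_submodule M' \<Longrightarrow> invariant_submodule (M \<inter> M')"
  by (simp add: invariant_submodule_def subspace_inter) blast

text \<open>The argument for the independence of eigenspaces: \<open>g j ^^ n - id\<close> kills one summand and maps the
  others into modules to which the induction hypothesis applies.\<close>

lemma independent_periodic:
  assumes M: "invariant_submodule M" and g: "\<And>i :: 'i. g i \<in> \<Gamma>"
    and disj: "\<And>i j. i \<noteq> j \<Longrightarrow> M \<inter> periodic_points (g i) \<inter> periodic_points (g j) \<subseteq> {0}"
    and "finite J" "\<And>i. i \<in> J \<Longrightarrow> a i \<in> M \<inter> periodic_points (g i)" "(\<Sum>i\<in>J. a i) = 0" "i \<in> J"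
  shows "a i = 0"
  using assms(4-)
proof (induction J arbitrary: a i rule: finite_induct)
  case (insert j J)
  obtain n where n: "n > 0" "(g j ^^ n) (a j) = a j"
    using insert.prems(1)[of j] by (auto simp: periodic_points_def)
  define G where "G = g j ^^ n"
  define T where "T x = G x - x" for x
  have G: "G \<in> \<Gamma>" unfolding G_def by (rule funpow_in[OF g])
  interpret h: module_hom s s G by (rule hom[OF G])
  have inv: "T x \<in> M'" if "invariant_submodule M'" "x \<in> M'" for x M'
    using that G unfolding T_def invariant_submodule_def
    by (intro subspace_diff) auto
  have "(\<Sum>i\<in>J. T (a i)) = G (\<Sum>i\<in>J. a i) - (\<Sum>i\<in>J. a i)"
    by (simp add: T_def sum_subtractf h.sum)
  also have "(\<Sum>i\<in>J. a i) = - a j"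
    using insert.prems(2) insert.hyps by (simp add: eq_neg_iff_add_eq_0 add.commute)
  also have "G (- a j) - (- a j) = 0" by (simp add: h.neg n flip: G_def) (simp add: G_def n)
  finally have "(\<Sum>i\<in>J. T (a i)) = 0" .
  moreover have "T (a i) \<in> M \<inter> periodic_points (g i)" if "i \<in> J" for i
    using insert.prems(1)[of i] that
    by (intro inv invariant_Int M invariant_periodic g) auto
  ultimately have "T (a i) = 0" if "i \<in> J" for i
    using insert.IH[of "\<lambda>i. T (a i)"] that by blast
  \<comment> \<open>\<open>T (a i) = 0\<close> says that \<open>g j ^^ n\<close> fixes
    \<open>a i\<close>, which is then periodic for both \<open>g i\<close> and
    \<open>g j\<close>.\<close>
  then have "a i \<in> periodic_points (g j)" if "i \<in> J" for i
    using n(1) that by (auto simp: T_def G_def periodic_points_def)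
  then have J0: "a i = 0" if "i \<in> J" for i
    using disj[of i j] insert.prems(1)[of i] insert.hyps that by blast
  then have "(\<Sum>i\<in>J. a i) = 0" by simp
  with insert.prems(2) insert.hyps have "a j = 0" by simp
  with J0 insert.prems(3) show ?case by blast
qed auto

lemma span_image_scaled_sum:
  assumes "y \<in> span (x ` {..<m::nat})"
  shows "\<exists>c. y = (\<Sum>i<m. s (c i) (x i))"
  using assms
proof (induction m arbitrary: y)
  case (Suc m)
  then obtain k where "y - s k (x m) \<in> span (x ` {..<m})"
    by (auto simp: lessThan_Suc span_insert)
  then obtain c where "y - s k (x m) = (\<Sum>i<m. s (c i) (x i))" using Suc.IH by blast
  then have "y = (\<Sum>i<Suc m. s ((c(m := k)) i) (x i))" by (simp add: algebra_simps)
  then show ?case by blast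
qed auto

text \<open>Nonzero elements \<open>x m\<close> chosen from every submodule would form a sequence in
  which some term is a combination of its predecessors, against
  \<open>independent_periodic\<close>.\<close>

lemma aperiodic_member:
  assumes M: "invariant_submodule M" and g: "\<And>i :: nat. g i \<in> \<Gamma>"
    and disj: "\<And>i j. i \<noteq> j \<Longrightarrow> M \<inter> periodic_points (g i) \<inter> periodic_points (g j) \<subseteq> {0}"
  shows "\<exists>m. M \<inter> periodic_points (g m) \<subseteq> {0}"
proof (rule ccontr)
  assume "\<not> ?thesis"
  then have "\<forall>m. \<exists>x. x \<in> M \<inter> periodic_points (g m) \<and> x \<noteq> 0" by blast
  then obtain x where x: "\<And>m. x m \<in> M \<inter> periodic_points (g m)" "\<And>m. x m \<noteq> 0" by metis
  obtain m where "x m \<in> span (x ` {..<m})" using noetherian by blast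
  then obtain c where c: "x m = (\<Sum>i<m. s (c i) (x i))" using span_image_scaled_sum by blast
  \<comment> \<open>The relation for \<open>x m\<close> brought to one side: the coefficient
    \<open>- 1\<close> at \<open>m\<close> makes \<open>a m = 0\<close> force
    \<open>x m = 0\<close>.\<close>
  define a where "a i = (if i = m then - x m else s (c i) (x i))" for i
  have sub: "subspace (M \<inter> periodic_points (g i))" for i
    using M invariant_periodic[OF g] by (auto simp: invariant_submodule_def subspace_inter)
  have "a m = 0"
  proof (rule independent_periodic[OF M g disj, where J = "{..m}" and a = a and i = m])
    show "a i \<in> M \<inter> periodic_points (g i)" for i
      using subspace_neg[OF sub x(1)] subspace_scale[OF sub x(1)] by (simp add: a_def)
    have "(\<Sum>i<m. a i) = x m" unfolding c by (intro sum.cong) (auto simp: a_def)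
    then show "(\<Sum>i\<in>{..m}. a i) = 0"
      by (simp add: a_def flip: lessThan_Suc_atMost)
  qed auto
  with x(2) show False by (simp add: a_def)
qed

text \<open>For a common period \<open>N\<close>, both \<open>h ^^ (i * N)\<close> and
  \<open>h ^^ (j * N)\<close> send \<open>a\<close> to the preimage of \<open>a\<close> under
  \<open>g ^^ N\<close>. Cancelling \<open>h ^^ (i * N)\<close> leaves the period
  \<open>(j - i) * N\<close> of \<open>a\<close> under \<open>h\<close>, and periodicity under
  \<open>g\<close> follows.\<close>

lemma periodic_twist:
  assumes g: "g \<in> \<Gamma>" and h: "h \<in> \<Gamma>" and ij: "i < j"
    and a: "a \<in> periodic_points (g \<circ> h ^^ i)" "a \<in> periodic_points (g \<circ> h ^^ j)"
  shows "a \<in> periodic_points g \<inter> periodic_points h"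
proof -
  have pow: "((g \<circ> h ^^ k) ^^ n) x = (g ^^ n) ((h ^^ (k * n)) x)" for k n x
    using funpow_comp_commute[OF comm[OF g funpow_in[OF h, of k]], of n] by (simp add: funpow_mult)
  obtain m n where mn: "m > 0" "n > 0" "((g \<circ> h ^^ i) ^^ m) a = a" "((g \<circ> h ^^ j) ^^ n) a = a"
    using a by (auto simp: periodic_points_def)
  define N where "N = m * n"
  have "N > 0" and Ni: "(g ^^ N) ((h ^^ (i * N)) a) = a" and Nj: "(g ^^ N) ((h ^^ (j * N)) a) = a"
    using mn funpow_fixed_mult[OF mn(3), of n] funpow_fixed_mult[OF mn(4), of m]
    unfolding pow N_def by (auto simp: mult.commute)
  have "(h ^^ (i * N)) a = (h ^^ (j * N)) a"
    by (rule injD[OF inj[OF funpow_in[OF g, of N]]]) (simp only: Ni Nj)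
  also have "\<dots> = (h ^^ (i * N)) ((h ^^ ((j - i) * N)) a)"
  proof -
    have "j * N = i * N + (j - i) * N" using add_mult_distrib[of i "j - i" N] ij by simp
    then show ?thesis by (metis funpow_add o_apply)
  qed
  finally have "a = (h ^^ ((j - i) * N)) a"
    by (rule injD[OF inj[OF funpow_in[OF h]]])
  then have ha: "(h ^^ ((j - i) * N)) a = a" by (rule sym)
  have P: "(j - i) * N > 0" using ij \<open>N > 0\<close> by simp
  \<comment> \<open>A multiple of the period \<open>N\<close> of \<open>g \<circ> h ^^ i\<close> for
    which \<open>i * ?K\<close> is a multiple of the period of \<open>h\<close>, so only
    \<open>g ^^ ?K\<close> remains.\<close>
  let ?K = "N * ((j - i) * N)"
  have "((g \<circ> h ^^ i) ^^ N) a = a" using Ni by (simp add: pow)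
  from funpow_fixed_mult[OF this, of "(j - i) * N"]
  have "(g ^^ ?K) ((h ^^ (i * ?K)) a) = a" unfolding pow by (simp only: mult.assoc)
  moreover have "(h ^^ (i * ?K)) a = a"
    using funpow_fixed_mult[OF ha, of "i * N"] by (simp add: ac_simps)
  ultimately have "(g ^^ ?K) a = a" by simp
  moreover have "?K > 0" using P \<open>N > 0\<close> by simp
  ultimately show ?thesis using ha P unfolding periodic_points_def by blast
qed

text \<open>The variable \<open>M\<close> carries the induction: on
  \<open>M \<inter> periodic_points h\<close> the remaining maps already have no nonzero common
  periodic point, so the hypothesis gives a \<open>g\<close> there. Then \<open>g\<close> and
  \<open>h\<close> have none on \<open>M\<close>, and some \<open>g \<circ> h ^^ m\<close> is
  aperiodic on \<open>M\<close>.\<close>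

lemma aperiodic_exists_on:
  assumes "finite S" "S \<subseteq> \<Gamma>" "invariant_submodule M" "M \<inter> (\<Inter>g\<in>S. periodic_points g) \<subseteq> {0}"
  shows "\<exists>g\<in>\<Gamma>. M \<inter> periodic_points g \<subseteq> {0}"
  using assms
proof (induction S arbitrary: M rule: finite_induct)
  case empty
  then show ?case using id_in by auto
next
  case (insert h S)
  have h: "h \<in> \<Gamma>" using insert.prems by auto
  have "\<exists>g\<in>\<Gamma>. (M \<inter> periodic_points h) \<inter> periodic_points g \<subseteq> {0}"
    using insert.prems h by (intro insert.IH invariant_Int invariant_periodic) auto
  then obtain g where g: "g \<in> \<Gamma>" "M \<inter> periodic_points h \<inter> periodic_points g \<subseteq> {0}" by blast
  have "\<exists>m. M \<inter> periodic_points (g \<circ> h ^^ m) \<subseteq> {0}"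
  proof (rule aperiodic_member)
    show "M \<inter> periodic_points (g \<circ> h ^^ i) \<inter> periodic_points (g \<circ> h ^^ j) \<subseteq> {0}" if "i \<noteq> j" for i j
    proof (cases "i < j")
      case True
      then show ?thesis using periodic_twist[OF g(1) h True] g(2) by blast
    next
      case False
      with that have "j < i" by simp
      then show ?thesis using periodic_twist[OF g(1) h \<open>j < i\<close>] g(2) by blast
    qed
  qed (use insert.prems g h in \<open>auto intro!: comp_in funpow_in\<close>)
  then show ?case using g h by (meson comp_in funpow_in)
qed

theorem aperiodic_exists:
  assumes "finite S" "S \<subseteq> \<Gamma>" "(\<Inter>g\<in>S. periodic_points g) \<subseteq> {0}"
  shows "\<exists>g\<in>\<Gamma>. periodic_points g \<subseteq> {0}"
  using aperiodic_exists_on[OF assms(1,2), of UNIV] assms(3)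
  by (auto simp: invariant_submodule_def)

text \<open>Containment in the orbit of \<open>a\<close> is part of the induction: by commutativity
  a period of \<open>h\<close> at \<open>a\<close> is then a period on all of \<open>A\<close>, so
  finitely many images of \<open>A\<close> under powers of \<open>h\<close> are permuted
  cyclically.\<close>

lemma finite_invariant_set:
  assumes "finite S" "S \<subseteq> \<Gamma>" "\<forall>g\<in>S. a \<in> periodic_points g"
  shows "\<exists>A. finite A \<and> a \<in> A \<and> (\<forall>g\<in>S. g ` A \<subseteq> A) \<and> A \<subseteq> (\<lambda>g. g a) ` \<Gamma>"
  using assms
proof (induction S rule: finite_induct)
  case empty
  have "a \<in> (\<lambda>g. g a) ` \<Gamma>" using id_in by (rule rev_image_eqI) simp
  then show ?case by (intro exI[of _ "{a}"]) simp
next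
  case (insert h S)
  then obtain A where A: "finite A" "a \<in> A" "\<forall>g\<in>S. g ` A \<subseteq> A" "A \<subseteq> (\<lambda>g. g a) ` \<Gamma>" by auto
  have h: "h \<in> \<Gamma>" using insert.prems by auto
  obtain n where n: "n > 0" "(h ^^ n) a = a" using insert.prems by (auto simp: periodic_points_def)
  have nA: "(h ^^ n) x = x" if x: "x \<in> A" for x
  proof -
    obtain g where "g \<in> \<Gamma>" "x = g a" using x A by auto
    then show ?thesis using comm[OF \<open>g \<in> \<Gamma>\<close> funpow_in[OF h, of n]] n(2) by (metis o_apply)
  qed
  let ?A = "\<Union>k<n. (h ^^ k) ` A"
  have "h ` ?A \<subseteq> ?A"
  proof
    fix y assume "y \<in> h ` ?A"
    then obtain k x where k: "k < n" "x \<in> A" "y = (h ^^ Suc k) x" by auto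
    show "y \<in> ?A"
    proof (cases "Suc k = n")
      case True
      with k nA have "y = (h ^^ 0) x" by simp
      with k n show ?thesis by blast
    next
      case False
      with k have "Suc k < n" by simp
      with k show ?thesis by blast
    qed
  qed
  moreover have "g ` ?A \<subseteq> ?A" if "g \<in> S" for g
  proof -
    have "g \<in> \<Gamma>" using that insert.prems by auto
    then have "g ((h ^^ k) x) = (h ^^ k) (g x)" for k x
      using comm[OF _ funpow_in[OF h, of k]] by (auto simp: fun_eq_iff)
    then show ?thesis using A(3) that by fastforce
  qed
  moreover have "?A \<subseteq> (\<lambda>g. g a) ` \<Gamma>"
  proof
    fix y assume "y \<in> ?A"
    then obtain k g where "g \<in> \<Gamma>" "y = (h ^^ k \<circ> g) a" using A by auto
    then show "y \<in> (\<lambda>g. g a) ` \<Gamma>" using comp_in[OF funpow_in[OF h]] by blast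
  qed
  moreover have "a \<in> ?A" using n A(2) by (auto intro!: bexI[of _ 0] rev_image_eqI)
  ultimately show ?case using A(1) by (intro exI[of _ ?A]) auto
qed

end


section \<open>Trigonometric polynomials on the dual\<close>

text \<open>A copy of the type of functions that carries the class \<^class>\<open>t2_space\<close>, in which the library
  states the Stone-Weierstrass theorem: the function type itself has the \<open>T\<^sub>0\<close> class only for
  countable domains and metrizable codomains, which rules out an instance for all domains.\<close>

typedef 'n complex_function = "UNIV :: ('n \<Rightarrow> complex) set"
  by simp

instantiation complex_function :: (type) t2_space
begin

definition open_complex_function :: "'a complex_function set \<Rightarrow> bool" where
  "open_complex_function U \<longleftrightarrow> open (Abs_complex_function -` U)"

instance
proof
  show "open (UNIV :: 'a complex_function set)" by (simp add: open_complex_function_def)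
  show "open (U \<inter> V)" if "open U" "open V" for U V :: "'a complex_function set"
    using that by (simp add: open_complex_function_def open_Int)
  show "open (\<Union>\<U>)" if "\<forall>U\<in>\<U>. open U" for \<U> :: "'a complex_function set set"
    using that by (auto simp: open_complex_function_def vimage_Union)
  fix x y :: "'a complex_function"
  assume "x \<noteq> y"
  then have "Rep_complex_function x \<noteq> Rep_complex_function y"
    by (simp add: Rep_complex_function_inject)
  then obtain i where "Rep_complex_function x i \<noteq> Rep_complex_function y i" by blast
  then obtain U V where UV: "open U" "open V" "Rep_complex_function x i \<in> U"
      "Rep_complex_function y i \<in> V" "U \<inter> V = {}"
    using separation_t2 by metis
  have "open ((\<lambda>f. Rep_complex_function f i) -` W)" if "open W" for W :: "complex set"
    using open_vimage[OF that continuous_on_product_coordinates]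
    by (simp add: open_complex_function_def vimage_def Abs_complex_function_inverse)
  with UV show "\<exists>U V. open U \<and> open V \<and> x \<in> U \<and> y \<in> V \<and> U \<inter> V = {}"
    by (intro exI[of _ "(\<lambda>f. Rep_complex_function f i) -` U"]
        exI[of _ "(\<lambda>f. Rep_complex_function f i) -` V"]) auto
qed

end

lemma Rep_Abs_complex_function [simp]: "Rep_complex_function (Abs_complex_function f) = f"
  by (simp add: Abs_complex_function_inverse)

lemma continuous_Abs_complex_function: "continuous_on X Abs_complex_function"
  by (rule continuous_on_subset[of UNIV])
    (auto simp: continuous_on_open_vimage open_complex_function_def)

lemma continuous_Rep_complex_function: "continuous_on X Rep_complex_function"
proof -
  have "Abs_complex_function -` (Rep_complex_function -` U) = U" for U :: "('a \<Rightarrow> complex) set"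
    by auto
  then have "continuous_on UNIV (Rep_complex_function :: 'a complex_function \<Rightarrow> _)"
    by (simp add: continuous_on_open_vimage open_complex_function_def)
  then show ?thesis by (rule continuous_on_subset) simp
qed

text \<open>Compactness passes to the Hausdorff copy \<open>complex_function\<close>, and closedness
  passes back.\<close>

lemma compact_imp_closed_functions: "compact C \<Longrightarrow> closed C" for C :: "('n \<Rightarrow> complex) set"
proof -
  assume "compact C"
  have "compact (Abs_complex_function ` C)"
    using \<open>compact C\<close> by (intro compact_continuous_image continuous_Abs_complex_function)
  then have "closed (Abs_complex_function ` C)" by (rule compact_imp_closed)
  then have "closed (Abs_complex_function -` Abs_complex_function ` C)"
    by (intro closed_vimage continuous_Abs_complex_function)
  moreover have "Abs_complex_function -` Abs_complex_function ` C = C"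
    by (auto simp: Abs_complex_function_inject)
  ultimately show "closed C" by simp
qed

definition char_mult :: "('n \<Rightarrow> complex) \<Rightarrow> ('n \<Rightarrow> complex) \<Rightarrow> 'n \<Rightarrow> complex" where
  "char_mult c d = (\<lambda>a. c a * d a)"

abbreviation characters :: "('n::ab_group_add \<Rightarrow> complex) set" where
  "characters \<equiv> carrier dual_group"

lemma character_norm: "c \<in> characters \<Longrightarrow> norm (c a) = 1"
  and character_add: "c \<in> characters \<Longrightarrow> c (a + b) = c a * c b"
  by (auto simp: dual_group_def)

lemma character_zero: "c \<in> characters \<Longrightarrow> c 0 = 1"
  using character_add[of c 0 0] character_norm[of c 0] by auto

lemma character_uminus: "c \<in> characters \<Longrightarrow> c (- a) = cnj (c a)"
proof -
  assume c: "c \<in> characters"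
  have "c (- a) * c a = 1" using character_add[OF c, of "- a" a] character_zero[OF c] by simp
  moreover have "cnj (c a) * c a = 1"
    using complex_norm_square[of "c a"] character_norm[OF c, of a] by (simp add: mult.commute)
  ultimately show "c (- a) = cnj (c a)" by (metis mult.assoc mult.commute mult_1_right)
qed

lemma char_mult_in: "c \<in> characters \<Longrightarrow> d \<in> characters \<Longrightarrow> char_mult c d \<in> characters"
  by (auto simp: dual_group_def char_mult_def norm_mult)

lemma characters_comp: "c \<in> characters \<Longrightarrow> (\<And>a b. g (a + b) = g a + g b) \<Longrightarrow> c \<circ> g \<in> characters"
  by (auto simp: dual_group_def)

lemma compact_characters: "compact (characters :: ('n::ab_group_add \<Rightarrow> complex) set)"
  using compact_space_dual_topology[where 'n = 'n]
  by (simp add: dual_topology_def compact_space_def compactin_subtopology)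

lemma continuous_evaluation: "continuous_on X (\<lambda>c :: 'n \<Rightarrow> complex. c a)"
  by (rule continuous_on_subset[OF continuous_on_product_coordinates]) simp

lemma continuous_into_functions:
  fixes f :: "('n \<Rightarrow> complex) \<Rightarrow> 'm \<Rightarrow> complex"
  assumes "\<And>a. continuous_on X (\<lambda>c. f c a)" shows "continuous_on X f"
  using assms by (rule continuous_on_coordinatewise_then_product)

text \<open>Identities such as \<open>c (a + b) = c a * c b\<close> hold only for characters, while
  the functions are defined on all \<open>c\<close>; the rule \<open>cong\<close> identifies
  functions that agree on characters.\<close>

inductive trig_poly :: "(('n::ab_group_add \<Rightarrow> complex) \<Rightarrow> complex) \<Rightarrow> bool" where
  monomial: "trig_poly (\<lambda>c. k * c a)"
| add: "trig_poly p \<Longrightarrow> trig_poly q \<Longrightarrow> trig_poly (\<lambda>c. p c + q c)"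
| cong: "trig_poly p \<Longrightarrow> (\<And>c. c \<in> characters \<Longrightarrow> p c = q c) \<Longrightarrow> trig_poly q"

lemma trig_poly_mult:
  assumes "trig_poly p" "trig_poly q" shows "trig_poly (\<lambda>c. p c * q c)"
  using assms(1)
proof induction
  case (monomial k a)
  show ?case using assms(2)
  proof induction
    case (monomial l b)
    show ?case
      by (rule trig_poly.cong[OF trig_poly.monomial[of "k * l" "a + b"]]) (simp add: character_add)
  next
    case (add p q)
    show ?case by (rule trig_poly.cong[OF trig_poly.add[OF add.IH]]) (simp add: algebra_simps)
  next
    case (cong p q)
    show ?case by (rule trig_poly.cong[OF cong.IH]) (simp add: cong.hyps)
  qed
next
  case (add p p')
  show ?case by (rule trig_poly.cong[OF trig_poly.add[OF add.IH]]) (simp add: algebra_simps)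
next
  case (cong p p')
  show ?case by (rule trig_poly.cong[OF cong.IH]) (simp add: cong.hyps)
qed

lemma trig_poly_const: "trig_poly (\<lambda>_. k)"
  by (rule trig_poly.cong[OF trig_poly.monomial[of k 0]]) (simp add: character_zero)

lemma trig_poly_continuous: "trig_poly p \<Longrightarrow> continuous_on characters p"
proof (induction rule: trig_poly.induct)
  case (cong p q)
  then show ?case by (metis continuous_on_cong)
qed (auto intro!: continuous_intros continuous_evaluation)

text \<open>On characters \<open>c (- a)\<close> is the conjugate of \<open>c a\<close>. The
  coefficients are those of half the sum and of the difference divided by
  \<open>2 * \<i>\<close>.\<close>

lemma trig_poly_Re_Im:
  "trig_poly (\<lambda>c. of_real (Re (c a)))" "trig_poly (\<lambda>c. of_real (Im (c a)))"
proof -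
  show "trig_poly (\<lambda>c. of_real (Re (c a)))"
    by (rule trig_poly.cong[OF trig_poly.add[OF trig_poly.monomial[of "1 / 2" a] trig_poly.monomial[of "1 / 2" "- a"]]])
      (simp add: character_uminus complex_eq_iff)
  show "trig_poly (\<lambda>c. of_real (Im (c a)))"
    by (rule trig_poly.cong[OF trig_poly.add[OF trig_poly.monomial[of "- \<i> / 2" a] trig_poly.monomial[of "\<i> / 2" "- a"]]])
      (simp add: character_uminus complex_eq_iff)
qed

text \<open>Real-valued trigonometric polynomials form an algebra of continuous functions that
  contains the constants and separates the points of a compact space, as the Stone-Weierstrass
  theory demands.\<close>

lemma trig_poly_separates_sets:
  fixes A B :: "('n::ab_group_add \<Rightarrow> complex) set"
  assumes "compact A" "A \<subseteq> characters" "compact B" "B \<subseteq> characters" "A \<inter> B = {}" "0 < e" "e < 1"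
  obtains f :: "('n \<Rightarrow> complex) \<Rightarrow> real" where "trig_poly (\<lambda>c. of_real (f c))"
    "\<And>c. c \<in> characters \<Longrightarrow> 0 \<le> f c \<and> f c \<le> 1" "\<And>c. c \<in> A \<Longrightarrow> f c < e" "\<And>c. c \<in> B \<Longrightarrow> f c > 1 - e"
proof -
  let ?R = "{f :: 'n complex_function \<Rightarrow> real. trig_poly (\<lambda>c. of_real (f (Abs_complex_function c)))}"
  have cont: "continuous_on (Abs_complex_function ` characters) f" if "f \<in> ?R" for f
  proof -
    have "continuous_on characters (\<lambda>c. f (Abs_complex_function c))"
      using continuous_on_Re[OF trig_poly_continuous[of "\<lambda>c. of_real (f (Abs_complex_function c))"]] that
      by simp
    then have "continuous_on (Abs_complex_function ` characters)
        ((\<lambda>c. f (Abs_complex_function c)) \<circ> Rep_complex_function)"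
      by (intro continuous_on_compose continuous_Rep_complex_function) (simp add: image_image)
    then show ?thesis by (simp add: Rep_complex_function_inverse o_def)
  qed
  interpret function_ring_on ?R "Abs_complex_function ` characters"
  proof
    show "\<exists>f\<in>?R. f x \<noteq> f y" if "x \<noteq> y" for x y :: "'n complex_function"
    proof -
      have "Rep_complex_function x \<noteq> Rep_complex_function y"
        using that by (simp add: Rep_complex_function_inject)
      then obtain a where "Rep_complex_function x a \<noteq> Rep_complex_function y a" by blast
      then consider "Re (Rep_complex_function x a) \<noteq> Re (Rep_complex_function y a)"
        | "Im (Rep_complex_function x a) \<noteq> Im (Rep_complex_function y a)"
        using complex_eqI by blast
      then show ?thesis
      proof cases
        case 1
        then show ?thesis
          using trig_poly_Re_Im(1)[of a] by (intro bexI[of _ "\<lambda>x. Re (Rep_complex_function x a)"]) simp_all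
      next
        case 2
        then show ?thesis
          using trig_poly_Re_Im(2)[of a] by (intro bexI[of _ "\<lambda>x. Im (Rep_complex_function x a)"]) simp_all
      qed
    qed
    show "(\<lambda>x. f x + g x) \<in> ?R" if "f \<in> ?R" "g \<in> ?R" for f g
      using trig_poly.add[of "\<lambda>c. of_real (f (Abs_complex_function c))" "\<lambda>c. of_real (g (Abs_complex_function c))"] that
      by (simp only: mem_Collect_eq of_real_add)
    show "(\<lambda>x. f x * g x) \<in> ?R" if "f \<in> ?R" "g \<in> ?R" for f g
      using trig_poly_mult[of "\<lambda>c. of_real (f (Abs_complex_function c))" "\<lambda>c. of_real (g (Abs_complex_function c))"] that
      by (simp only: mem_Collect_eq of_real_mult)
    show "(\<lambda>_. k) \<in> ?R" for k
      using trig_poly_const by simp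
    show "compact (Abs_complex_function ` characters :: 'n complex_function set)"
      by (intro compact_continuous_image compact_characters continuous_Abs_complex_function)
  qed (rule cont)
  have comp: "compact (Abs_complex_function ` A)" "compact (Abs_complex_function ` B)"
    using assms by (auto intro!: compact_continuous_image continuous_Abs_complex_function)
  have "\<exists>f\<in>?R. f ` Abs_complex_function ` characters \<subseteq> {0..1} \<and>
      (\<forall>x\<in>Abs_complex_function ` A. f x < e) \<and> (\<forall>x\<in>Abs_complex_function ` B. f x > 1 - e)"
    \<comment> \<open>\<open>two\<close> is the fact of \<open>function_ring_on\<close> that
      separates two disjoint closed sets up to \<open>e\<close> with values in the unit
      interval.\<close>
    using assms comp by (intro two) (auto simp: compact_imp_closed Abs_complex_function_inject)
  then obtain f where "f \<in> ?R" "f ` Abs_complex_function ` characters \<subseteq> {0..1}"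
    "\<forall>x\<in>Abs_complex_function ` A. f x < e" "\<forall>x\<in>Abs_complex_function ` B. f x > 1 - e" by blast
  then show ?thesis by (intro that[of "\<lambda>c. f (Abs_complex_function c)"]) (auto simp: image_subset_iff)
qed


section \<open>Closed subgroups of the dual\<close>

text \<open>\<open>char_average hs p\<close> is the mean of \<open>p\<close> over the products of the subfamilies of \<open>hs\<close>.\<close>

fun char_average :: "('n \<Rightarrow> complex) list \<Rightarrow> (('n \<Rightarrow> complex) \<Rightarrow> complex) \<Rightarrow> complex" where
  "char_average [] p = p (\<lambda>_. 1)"
| "char_average (h # hs) p = (char_average hs p + char_average hs (\<lambda>c. p (char_mult h c))) / 2"

lemma char_average_add:
  "char_average hs (\<lambda>c. p c + q c) = char_average hs p + char_average hs q"
  by (induction hs arbitrary: p q) (auto simp: field_simps)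

text \<open>Summing over all subproducts of \<open>hs\<close> expands the product of the factors
  \<open>1 + h a\<close>, so the average factorises.\<close>

lemma char_average_monomial:
  "char_average hs (\<lambda>c. k * c a) = k * (\<Prod>h\<leftarrow>hs. (1 + h a) / 2)"
proof (induction hs arbitrary: k)
  case (Cons h hs)
  have "char_average hs (\<lambda>c. k * char_mult h c a) = (k * h a) * (\<Prod>h\<leftarrow>hs. (1 + h a) / 2)"
    using Cons[of "k * h a"] by (simp add: char_mult_def mult.assoc)
  with Cons[of k] show ?case by (simp add: field_simps)
qed auto

text \<open>All subproducts of \<open>hs\<close> stay in the subgroup, and a mean stays in a convex
  set; with open half lines for \<open>J\<close>, strict bounds survive averaging.\<close>

lemma char_average_Re_mem:
  assumes L: "subgroup L dual_group" and "set hs \<subseteq> L" and J: "convex J"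
    and "\<And>c. c \<in> L \<Longrightarrow> Re (p c) \<in> J"
  shows "Re (char_average hs p) \<in> J"
  using assms(2,4)
proof (induction hs arbitrary: p)
  case Nil
  then show ?case using subgroup.one_closed[OF L] by (simp add: dual_group_def)
next
  case (Cons h hs)
  have "char_mult h c \<in> L" if "c \<in> L" for c
    using subgroup.m_closed[OF L, of h c] Cons.prems that by (simp add: dual_group_def char_mult_def)
  then have "Re (char_average hs p) \<in> J" "Re (char_average hs (\<lambda>c. p (char_mult h c))) \<in> J"
    using Cons.prems by (auto intro!: Cons.IH)
  from convexD[OF J this, of "1/2" "1/2"] show ?case by (simp add: field_simps)
qed

lemma char_average_cong:
  assumes "set hs \<subseteq> characters" "\<And>c. c \<in> characters \<Longrightarrow> p c = q c"
  shows "char_average hs p = char_average hs q"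
  using assms
proof (induction hs arbitrary: p q)
  case Nil
  then show ?case by (simp add: dual_group_def)
next
  case (Cons h hs)
  have "char_average hs p = char_average hs q" using Cons.prems by (intro Cons.IH) auto
  moreover have "char_average hs (\<lambda>c. p (char_mult h c)) = char_average hs (\<lambda>c. q (char_mult h c))"
    using Cons.prems by (intro Cons.IH) (auto simp: char_mult_in)
  ultimately show ?case by simp
qed

lemma norm_half_sum_le: "norm (w::complex) = 1 \<Longrightarrow> norm ((1 + w) / 2) \<le> 1"
  using norm_triangle_ineq[of 1 w] by (simp add: norm_divide)

text \<open>The midpoint of two distinct points of the circle is interior: the squared norm of
  \<open>1 + w\<close> is \<open>2 + 2 * Re w\<close>, and \<open>Re w < 1\<close>.\<close>

lemma norm_half_sum_less:
  assumes "norm (w::complex) = 1" "w \<noteq> 1" shows "norm ((1 + w) / 2) < 1"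
proof -
  have 1: "(Re w)\<^sup>2 + (Im w)\<^sup>2 = 1" using assms(1) by (simp add: cmod_def)
  have "Re w \<noteq> 1"
  proof
    assume "Re w = 1"
    with 1 have "Im w = 0" by simp
    with \<open>Re w = 1\<close> assms(2) show False by (simp add: complex_eq_iff)
  qed
  moreover have "Re w \<le> 1" using complex_Re_le_cmod[of w] assms(1) by simp
  ultimately have "(norm (1 + w))\<^sup>2 < 2\<^sup>2"
    using 1 by (simp add: cmod_power2 power2_sum) 
  then have "norm (1 + w) < 2" by (rule power_less_imp_less_base) simp
  then show ?thesis by (simp add: norm_divide)
qed

text \<open>Repeating an \<open>h\<close> with \<open>h b \<noteq> 1\<close> sufficiently often
  makes the factor at \<open>b\<close> small, and no factor at any other point exceeds 1 in norm, so
  earlier bounds persist.\<close>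

lemma average_kills_characters:
  assumes "finite B" "\<And>a. a \<in> B \<Longrightarrow> \<exists>h\<in>L. h a \<noteq> 1" "L \<subseteq> characters" "0 < e"
  shows "\<exists>hs. set hs \<subseteq> L \<and> (\<forall>a\<in>B. norm (\<Prod>h\<leftarrow>hs. (1 + h a) / 2) \<le> e)"
  using assms(1,2)
proof (induction rule: finite_induct)
  case empty
  then show ?case by (intro exI[of _ "[]"]) auto
next
  case (insert b B)
  obtain hs where hs: "set hs \<subseteq> L" "\<forall>a\<in>B. norm (\<Prod>h\<leftarrow>hs. (1 + h a) / 2) \<le> e"
    using insert by auto
  obtain h where h: "h \<in> L" "h b \<noteq> 1" using insert.prems by auto
  have n1: "norm ((1 + g a) / 2) \<le> 1" if "g \<in> L" for g a
    using that assms(3) by (intro norm_half_sum_le) (auto simp: character_norm)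
  have nprod: "norm (\<Prod>h\<leftarrow>gs. (1 + h a) / 2) \<le> 1" if "set gs \<subseteq> L" for gs a
    using that
  proof (induction gs)
    case (Cons g gs)
    then have "norm ((1 + g a) / 2) * norm (\<Prod>h\<leftarrow>gs. (1 + h a) / 2) \<le> 1"
      by (intro mult_le_one n1) auto
    then show ?case by (simp only: list.map prod_list.Cons norm_mult)
  qed auto
  have "norm ((1 + h b) / 2) < 1"
    using h assms(3) by (intro norm_half_sum_less) (auto simp: character_norm)
  then obtain N where N: "norm ((1 + h b) / 2) ^ N < e"
    using real_arch_pow_inv[OF assms(4)] by blast
  have rep: "(\<Prod>g\<leftarrow>replicate N h. (1 + g a) / 2) = ((1 + h a) / 2) ^ N" for a
    by (induction N) auto
  let ?hs = "replicate N h @ hs"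
  have eq: "norm (\<Prod>g\<leftarrow>?hs. (1 + g a) / 2) =
      norm ((1 + h a) / 2) ^ N * norm (\<Prod>g\<leftarrow>hs. (1 + g a) / 2)" for a
    by (simp only: map_append prod_list.append norm_mult rep norm_power)
  have "norm (\<Prod>g\<leftarrow>?hs. (1 + g a) / 2) \<le> e" if "a \<in> insert b B" for a
  proof (cases "a = b")
    case True
    have "norm ((1 + h b) / 2) ^ N * norm (\<Prod>g\<leftarrow>hs. (1 + g b) / 2) \<le> e * 1"
      using N nprod[OF hs(1)] assms(4) by (intro mult_mono) auto
    then show ?thesis by (simp only: eq True mult_1_right)
  next
    case False
    have "norm ((1 + h a) / 2) ^ N * norm (\<Prod>g\<leftarrow>hs. (1 + g a) / 2) \<le> 1 * e"
      using hs(2) n1[OF h(1)] that False by (intro mult_mono power_le_one) auto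
    then show ?thesis by (simp only: eq mult_1_left)
  qed
  moreover have "set ?hs \<subseteq> L" using h hs by auto
  ultimately show ?case by blast
qed

text \<open>\<open>B\<close> and \<open>C\<close> serve all lists \<open>hs\<close> at once, so
  \<open>hs\<close> can be chosen after them to make the averages over \<open>B\<close>
  small.\<close>

definition translate_bound ::
    "('n::ab_group_add \<Rightarrow> complex) set \<Rightarrow> ('n \<Rightarrow> complex) \<Rightarrow> (('n \<Rightarrow> complex) \<Rightarrow> complex) \<Rightarrow> 'n set \<Rightarrow> real \<Rightarrow> bool" where
  "translate_bound L z p B C \<longleftrightarrow> (\<forall>hs e. set hs \<subseteq> L \<longrightarrow>
     (\<forall>a\<in>B. norm (\<Prod>h\<leftarrow>hs. (1 + h a) / 2) \<le> e) \<longrightarrow> 0 \<le> e \<longrightarrow>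
     norm (char_average hs p - char_average hs (\<lambda>c. p (char_mult z c))) \<le> C * e)"

text \<open>If \<open>z\<close> is trivial on the annihilator of \<open>L\<close>, then averages over \<open>L\<close> cannot
  tell \<open>L\<close> from \<open>z L\<close>.\<close>

lemma average_translate_diff:
  assumes "trig_poly p" and z: "z \<in> characters" and L: "L \<subseteq> characters"
    and ann: "\<And>a. (\<forall>c\<in>L. c a = 1) \<Longrightarrow> z a = 1"
  shows "\<exists>B C. finite B \<and> 0 \<le> C \<and> (\<forall>a\<in>B. \<exists>h\<in>L. h a \<noteq> 1) \<and> translate_bound L z p B C"
  using assms(1)
proof induction
  case (monomial k a)
  have eq: "char_average hs (\<lambda>c. k * c a) - char_average hs (\<lambda>c. k * char_mult z c a) =
      k * (1 - z a) * (\<Prod>h\<leftarrow>hs. (1 + h a) / 2)" for hs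
    using char_average_monomial[of hs k a] char_average_monomial[of hs "k * z a" a]
    by (simp add: char_mult_def algebra_simps)
  \<comment> \<open>Translation by \<open>z\<close> multiplies this term by \<open>z a\<close>. On
    the annihilator of \<open>L\<close> that factor is 1 and nothing changes; otherwise
    \<open>a\<close> goes into \<open>B\<close>.\<close>
  show ?case
  proof (cases "\<forall>c\<in>L. c a = 1")
    case True
    with ann have "translate_bound L z (\<lambda>c. k * c a) {} 0"
      unfolding translate_bound_def eq by simp
    then show ?thesis by (intro exI[of _ "{}"] exI[of _ 0]) simp
  next
    case False
    have "translate_bound L z (\<lambda>c. k * c a) {a} (norm k * norm (1 - z a))"
      unfolding translate_bound_def eq norm_mult by (auto intro!: mult_left_mono)
    with False show ?thesis
      by (intro exI[of _ "{a}"] exI[of _ "norm k * norm (1 - z a)"]) simp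
  qed
next
  case (add p q)
  obtain B C where B: "finite B" "0 \<le> C" "\<forall>a\<in>B. \<exists>h\<in>L. h a \<noteq> 1" and BC: "translate_bound L z p B C"
    using add.IH(1) by blast
  obtain B' C' where B': "finite B'" "0 \<le> C'" "\<forall>a\<in>B'. \<exists>h\<in>L. h a \<noteq> 1" and BC': "translate_bound L z q B' C'"
    using add.IH(2) by blast
  have "translate_bound L z (\<lambda>c. p c + q c) (B \<union> B') (C + C')"
    unfolding translate_bound_def
  proof (intro allI impI)
    fix hs and e :: real
    assume hs: "set hs \<subseteq> L" "\<forall>a\<in>B \<union> B'. norm (\<Prod>h\<leftarrow>hs. (1 + h a) / 2) \<le> e" "0 \<le> e"
    let ?D = "\<lambda>p. char_average hs p - char_average hs (\<lambda>c. p (char_mult z c))"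
    have "?D (\<lambda>c. p c + q c) = ?D p + ?D q" by (simp add: char_average_add)
    moreover have "norm (?D p) \<le> C * e"
      by (rule BC[unfolded translate_bound_def, rule_format]) (use hs in auto)
    moreover have "norm (?D q) \<le> C' * e"
      by (rule BC'[unfolded translate_bound_def, rule_format]) (use hs in auto)
    moreover have "norm (?D p + ?D q) \<le> norm (?D p) + norm (?D q)" by (rule norm_triangle_ineq)
    ultimately show "norm (?D (\<lambda>c. p c + q c)) \<le> (C + C') * e"
      by (simp only: distrib_right)
  qed
  with B B' show ?case by (intro exI[of _ "B \<union> B'"] exI[of _ "C + C'"]) auto
next
  case (cong p q)
  have "char_average hs q = char_average hs p"
    and "char_average hs (\<lambda>c. q (char_mult z c)) = char_average hs (\<lambda>c. p (char_mult z c))"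
    if "set hs \<subseteq> L" for hs
  proof -
    have hs: "set hs \<subseteq> characters" using that L by blast
    show "char_average hs q = char_average hs p"
      by (rule char_average_cong[OF hs]) (simp add: cong.hyps)
    show "char_average hs (\<lambda>c. q (char_mult z c)) = char_average hs (\<lambda>c. p (char_mult z c))"
      by (rule char_average_cong[OF hs]) (simp add: cong.hyps char_mult_in z)
  qed
  then have "translate_bound L z q B C" if "translate_bound L z p B C" for B C
    using that unfolding translate_bound_def by simp
  with cong.IH show ?case by blast
qed

text \<open>Otherwise \<open>L\<close> and its translate by \<open>z\<close> are disjoint and
  compact, and some trigonometric polynomial is below 1/4 on the first and above 3/4 on the second.
  Averages over \<open>L\<close> keep this gap of 1/2, but \<open>average_translate_diff\<close>
  makes them closer than that.\<close>

theorem closed_subgroup_biannihilator: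
  assumes L: "subgroup L dual_group" and cl: "closedin dual_topology L" and z: "z \<in> characters"
    and ann: "\<And>a. (\<forall>c\<in>L. c a = 1) \<Longrightarrow> z a = 1"
  shows "z \<in> L"
proof (rule ccontr)
  assume "z \<notin> L"
  have LK: "L \<subseteq> characters" by (rule subgroup.subset[OF L])
  have "compactin dual_topology L"
    by (rule closedin_compact_space[OF compact_space_dual_topology cl])
  then have cL: "compact L" by (simp add: dual_topology_def compactin_subtopology)
  \<comment> \<open>A common point \<open>z c\<close> with \<open>c\<close> in \<open>L\<close>
    would put \<open>z\<close>, the product of \<open>z c\<close> with the inverse of
    \<open>c\<close>, into \<open>L\<close>.\<close>
  have "char_mult z ` L \<inter> L = {}"
  proof (rule ccontr)
    assume "\<not> ?thesis"
    then obtain c where c: "c \<in> L" "char_mult z c \<in> L" by auto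
    have "(\<lambda>a. cnj (c a)) = inv\<^bsub>dual_group\<^esub> c"
    proof (rule group.inv_equality[symmetric])
      show "group dual_group" using comm_group_dual_group by (rule comm_group.axioms(2))
      show "c \<in> characters" using c LK by auto
      then show "(\<lambda>a. cnj (c a)) \<in> characters" "(\<lambda>a. cnj (c a)) \<otimes>\<^bsub>dual_group\<^esub> c = \<one>\<^bsub>dual_group\<^esub>"
        by (auto simp: dual_group_def fun_eq_iff mult.commute complex_norm_square[symmetric])
    qed
    then have "(\<lambda>a. cnj (c a)) \<in> L" using subgroup.m_inv_closed[OF L c(1)] by simp
    from subgroup.m_closed[OF L c(2) this] have "(\<lambda>a. z a * (c a * cnj (c a))) \<in> L"
      by (simp add: dual_group_def char_mult_def mult.assoc)
    moreover have "c a * cnj (c a) = 1" for a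
      using character_norm[of c a] c LK by (auto simp: complex_norm_square[symmetric])
    ultimately show False using \<open>z \<notin> L\<close> by simp
  qed
  moreover have "compact (char_mult z ` L)"
    by (intro compact_continuous_image cL continuous_into_functions)
      (auto simp: char_mult_def intro!: continuous_intros continuous_evaluation)
  moreover have "char_mult z ` L \<subseteq> characters" using z LK by (auto intro: char_mult_in)
  ultimately obtain f where f: "trig_poly (\<lambda>c. of_real (f c))"
    and f0: "\<And>c. c \<in> L \<Longrightarrow> f c < 1/4" and f1: "\<And>c. c \<in> char_mult z ` L \<Longrightarrow> f c > 1 - 1/4"
    by (elim trig_poly_separates_sets[OF cL LK, of "char_mult z ` L" "1/4"]) auto
  obtain B C where B: "finite B" "0 \<le> C" "\<forall>a\<in>B. \<exists>h\<in>L. h a \<noteq> 1"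
    and BC: "translate_bound L z (\<lambda>c. of_real (f c)) B C"
    using average_translate_diff[OF f z LK ann] by blast
  \<comment> \<open>Chosen so that \<open>C * e\<close> stays below the gap 1/2; the summand 1
    covers \<open>C = 0\<close>.\<close>
  define e where "e = 1 / (2 * (C + 1))"
  have e: "0 < e" "C * e < 1/2" using B(2) by (auto simp: e_def field_simps)
  obtain hs where hs: "set hs \<subseteq> L" "\<forall>a\<in>B. norm (\<Prod>h\<leftarrow>hs. (1 + h a) / 2) \<le> e"
    using average_kills_characters[OF B(1) _ LK e(1)] B(3) by blast
  let ?u = "char_average hs (\<lambda>c. of_real (f c))" and ?v = "char_average hs (\<lambda>c. of_real (f (char_mult z c)))"
  have "norm (?u - ?v) < 1/2" 
    using BC[unfolded translate_bound_def, rule_format, OF hs(1), of e] hs(2) e by simp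
  moreover have "Re ?u \<in> {..<1/4}" using f0 by (intro char_average_Re_mem[OF L hs(1)]) auto
  moreover have "Re ?v \<in> {3/4<..}" using f1 by (intro char_average_Re_mem[OF L hs(1)]) fastforce+
  moreover have "\<bar>Re ?u - Re ?v\<bar> \<le> norm (?u - ?v)" using abs_Re_le_cmod[of "?u - ?v"] by simp
  ultimately show False by simp
qed


section \<open>Extension of characters\<close>

definition nat_multiple :: "nat \<Rightarrow> 'n::ab_group_add \<Rightarrow> 'n" where
  "nat_multiple n x = (\<Sum>i<n. x)"

lemma nat_multiple_simps:
  "nat_multiple 0 x = 0" "nat_multiple (Suc n) x = nat_multiple n x + x"
  by (simp_all add: nat_multiple_def)

lemma nat_multiple_add: "nat_multiple (m + n) x = nat_multiple m x + nat_multiple n x"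
  by (induction n) (auto simp: nat_multiple_simps add.assoc)

text \<open>Graphs of characters of subgroups.\<close>

definition partial_character :: "('n::ab_group_add \<times> complex) set \<Rightarrow> bool" where
  "partial_character G \<longleftrightarrow> (0, 1) \<in> G \<and>
     (\<forall>x u y v. (x, u) \<in> G \<longrightarrow> (y, v) \<in> G \<longrightarrow> (x + y, u * v) \<in> G) \<and>
     (\<forall>x u. (x, u) \<in> G \<longrightarrow> (- x, 1 / u) \<in> G \<and> norm u = 1) \<and>
     (\<forall>u. (0, u) \<in> G \<longrightarrow> u = 1)"

lemma partial_characterD:
  assumes "partial_character G"
  shows "(0, 1) \<in> G" "(x, u) \<in> G \<Longrightarrow> (y, v) \<in> G \<Longrightarrow> (x + y, u * v) \<in> G"
    "(x, u) \<in> G \<Longrightarrow> (- x, 1 / u) \<in> G" "(x, u) \<in> G \<Longrightarrow> norm u = 1" "(0, u) \<in> G \<Longrightarrow> u = 1"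
    "(x, u) \<in> G \<Longrightarrow> (y, v) \<in> G \<Longrightarrow> (x - y, u / v) \<in> G"
proof -
  show mult: "(x, u) \<in> G \<Longrightarrow> (y, v) \<in> G \<Longrightarrow> (x + y, u * v) \<in> G" for x u y v
    using assms by (simp add: partial_character_def)
  show "(0, 1) \<in> G" "(x, u) \<in> G \<Longrightarrow> (- x, 1 / u) \<in> G" "(x, u) \<in> G \<Longrightarrow> norm u = 1" "(0, u) \<in> G \<Longrightarrow> u = 1"
    using assms by (simp_all add: partial_character_def)
  show "(x - y, u / v) \<in> G" if "(x, u) \<in> G" "(y, v) \<in> G"
    using mult[OF that(1), of "- y" "1 / v"] that(2) assms by (simp add: partial_character_def)
qed

text \<open>For \<open>u = 1\<close> a primitive \<open>m\<close>-th root of unity serves, which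
  differs from 1 as \<open>m \<ge> 2\<close>; for other \<open>u\<close> no root equals 1.\<close>

lemma unit_root_not_1:
  assumes "norm (u :: complex) = 1" "m \<ge> 2"
  shows "\<exists>w. w \<noteq> 1 \<and> norm w = 1 \<and> w ^ m = u"
proof (cases "u = 1")
  case True
  have "cos (2 * pi / real m) < cos 0"
    using assms(2) pi_gt_zero by (intro cos_monotone_0_pi) (auto simp: field_simps)
  then have "cis (2 * pi / real m) \<noteq> 1" by (metis cis.simps(1) cos_zero less_irrefl one_complex.simps(1))
  moreover have "cis (2 * pi / real m) ^ m = 1"
    using assms(2) unfolding Complex.DeMoivre by simp
  ultimately show ?thesis using True by (intro exI[of _ "cis (2 * pi / real m)"]) simp
next
  case False
  obtain t where t: "u = cis t"
    using assms(1) unfolding complex_norm_eq_1_exp cis_conv_exp by metis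
  have p: "cis (t / real m) ^ m = u" using assms(2) unfolding Complex.DeMoivre t by simp
  with False have "cis (t / real m) \<noteq> 1" by auto
  with p show ?thesis by (intro exI[of _ "cis (t / real m)"]) simp
qed

text \<open>The value \<open>w\<close> at \<open>x\<close> only has to agree with \<open>G\<close>
  on the multiples of \<open>x\<close> in its domain. That it can avoid 1 is what later separates a
  point from 0.\<close>

lemma partial_character_extend:
  assumes G: "partial_character G" and x: "\<And>u. (x, u) \<notin> G"
  shows "\<exists>w G'. w \<noteq> 1 \<and> partial_character G' \<and> G \<subseteq> G' \<and> (x, w) \<in> G'"
proof -
  note D = partial_characterD[OF G]
  have "\<exists>w. w \<noteq> 1 \<and> norm w = 1 \<and> (\<forall>k u. (nat_multiple k x, u) \<in> G \<longrightarrow> u = w ^ k)"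
  proof (cases "\<exists>k>0. \<exists>u. (nat_multiple k x, u) \<in> G")
    case False
    \<comment> \<open>With no positive multiple of \<open>x\<close> in the domain, \<open>w\<close>
      is unconstrained and \<open>- 1\<close> is taken.\<close>
    then have "u = (- 1) ^ k" if "(nat_multiple k x, u) \<in> G" for k u
      using that D(5) by (cases "k = 0") (auto simp: nat_multiple_simps dest!: spec[of _ k])
    then show ?thesis by (intro exI[of _ "- 1"]) auto
  next
    case True
    \<comment> \<open>The order of \<open>x\<close> modulo the domain. It exceeds 1 because
      \<open>x\<close> lies outside, so the prescribed value at \<open>m\<close> times
      \<open>x\<close> has a root other than 1.\<close>
    define m where "m = (LEAST k. k > 0 \<and> (\<exists>u. (nat_multiple k x, u) \<in> G))"
    have m: "m > 0" "\<exists>u. (nat_multiple m x, u) \<in> G"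
      using LeastI_ex[of "\<lambda>k. k > 0 \<and> (\<exists>u. (nat_multiple k x, u) \<in> G)"] True by (auto simp: m_def)
    have least: "k = 0" if "k < m" "(nat_multiple k x, u) \<in> G" for k u
      using not_less_Least[of k "\<lambda>k. k > 0 \<and> (\<exists>u. (nat_multiple k x, u) \<in> G)"] that by (auto simp: m_def)
    obtain u0 where u0: "(nat_multiple m x, u0) \<in> G" using m by blast
    have "m \<noteq> 1" using u0 x by (auto simp: nat_multiple_simps)
    with m have m2: "m \<ge> 2" by simp
    have "norm u0 = 1" using D(4)[OF u0] .
    obtain w where w: "w \<noteq> 1" "norm w = 1" "w ^ m = u0"
      using unit_root_not_1[OF \<open>norm u0 = 1\<close> m2] by blast
    have "u = w ^ k" if "(nat_multiple k x, u) \<in> G" for k u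
      using that
    proof (induction k arbitrary: u rule: less_induct)
      case (less k)
      show ?case
      proof (cases "k < m")
        case True
        with least less.prems have "k = 0" by blast
        with less.prems D(5) show ?thesis by (simp add: nat_multiple_simps)
      next
        case False
        then have k: "k = (k - m) + m" by simp
        have "(nat_multiple k x - nat_multiple m x, u / u0) \<in> G" by (rule D(6)[OF less.prems u0])
        moreover have "nat_multiple k x - nat_multiple m x = nat_multiple (k - m) x"
          by (subst k, subst nat_multiple_add) simp
        ultimately have "u / u0 = w ^ (k - m)" using m False by (intro less.IH) auto
        moreover have "u0 \<noteq> 0" using \<open>norm u0 = 1\<close> by auto
        ultimately have "u = w ^ (k - m) * w ^ m" using w(3) by (simp add: field_simps)
        then show ?thesis using k by (metis power_add)
      qed
    qed
    with w show ?thesis by blast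
  qed
  then obtain w where w: "w \<noteq> 1" "norm w = 1"
    and wk: "\<And>k u. (nat_multiple k x, u) \<in> G \<Longrightarrow> u = w ^ k" by blast
  have w0: "w \<noteq> 0" using w by auto
  \<comment> \<open>Two natural exponents \<open>m\<close> and \<open>n\<close> encode the integer
    multiple \<open>m - n\<close> of \<open>x\<close>.\<close>
  define G' where "G' = {(y + nat_multiple m x - nat_multiple n x, u * w ^ m / w ^ n) | y u m n. (y, u) \<in> G}"
  have G'I: "(y, u) \<in> G \<Longrightarrow> z = y + nat_multiple m x - nat_multiple n x \<Longrightarrow> v = u * w ^ m / w ^ n \<Longrightarrow>
      (z, v) \<in> G'" for y u m n z v unfolding G'_def by blast
  have "partial_character G'"
    unfolding partial_character_def
  proof (intro conjI allI impI)
    show "(0, 1) \<in> G'" by (rule G'I[OF D(1), of _ 0 0]) (auto simp: nat_multiple_simps)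
  next
    fix a s b t assume "(a, s) \<in> G'" "(b, t) \<in> G'"
    then obtain y u m n y' u' m' n' where yu: "(y, u) \<in> G" "(y', u') \<in> G"
      and eq: "a = y + nat_multiple m x - nat_multiple n x" "s = u * w ^ m / w ^ n"
        "b = y' + nat_multiple m' x - nat_multiple n' x" "t = u' * w ^ m' / w ^ n'"
      unfolding G'_def by blast
    show "(a + b, s * t) \<in> G'"
      unfolding eq by (rule G'I[OF D(2)[OF yu], of _ "m + m'" "n + n'"])
        (simp_all add: nat_multiple_add power_add)
  next
    fix a s assume "(a, s) \<in> G'"
    then obtain y u m n where yu: "(y, u) \<in> G"
      and eq: "a = y + nat_multiple m x - nat_multiple n x" "s = u * w ^ m / w ^ n"
      unfolding G'_def by blast
    show "(- a, 1 / s) \<in> G'"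
      unfolding eq by (rule G'I[OF D(3)[OF yu], of _ n m]) simp_all
    show "norm s = 1" using D(4)[OF yu] w by (simp add: eq norm_mult norm_divide norm_power)
  next
    fix s assume "(0, s) \<in> G'"
    then obtain y u m n where yu: "(y, u) \<in> G"
      and eq: "0 = y + nat_multiple m x - nat_multiple n x" "s = u * w ^ m / w ^ n"
      unfolding G'_def by blast
    have "u \<noteq> 0" using D(4)[OF yu] by auto
    have y: "y = nat_multiple n x - nat_multiple m x"
      using eq(1) by (metis add_diff_cancel_right' diff_0 diff_diff_eq2 minus_diff_eq add.commute)
    have "u * w ^ m = w ^ n"
    proof (cases "m \<le> n")
      case True
      then have n: "n = (n - m) + m" by simp
      have "nat_multiple n x = nat_multiple (n - m) x + nat_multiple m x"
        by (subst n, rule nat_multiple_add)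
      with y have "y = nat_multiple (n - m) x" by simp
      with yu wk have "u = w ^ (n - m)" by blast
      then show ?thesis using True by (simp flip: power_add)
    next
      case False
      then have m: "m = (m - n) + n" by simp
      have "nat_multiple m x = nat_multiple (m - n) x + nat_multiple n x"
        by (subst m, rule nat_multiple_add)
      with y have "- y = nat_multiple (m - n) x" by simp
      with D(3)[OF yu] wk have "1 / u = w ^ (m - n)" by metis
      then have "w ^ m = (1 / u) * w ^ n" using False by (simp flip: power_add)
      then show ?thesis using \<open>u \<noteq> 0\<close> by simp
    qed
    then show "s = 1" using w0 by (simp add: eq)
  qed
  moreover have "G \<subseteq> G'"
  proof
    fix z assume "z \<in> G"
    then show "z \<in> G'" by (cases z) (auto intro!: G'I[of _ _ _ 0 0] simp: nat_multiple_simps)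
  qed
  moreover have "(x, w) \<in> G'" by (rule G'I[OF D(1), of _ "Suc 0" 0]) (auto simp: nat_multiple_simps)
  ultimately show ?thesis using w by blast
qed

text \<open>The trivial character of 0 is first extended to \<open>a\<close> with a value other than
  1, and Zorn's lemma is applied above that extension. A maximal element is defined everywhere,
  since any missing point could be adjoined.\<close>

theorem characters_separate_points:
  fixes a :: "'n::ab_group_add"
  assumes "a \<noteq> 0" shows "\<exists>c\<in>characters. c a \<noteq> 1"
proof -
  have "partial_character {(0 :: 'n, 1)}" by (auto simp: partial_character_def)
  then obtain w G1 where w: "w \<noteq> 1" and G1: "partial_character G1" "(a, w) \<in> G1"
    using partial_character_extend[of "{(0, 1)}" a] assms by auto
  let ?P = "{G. partial_character G \<and> G1 \<subseteq> G}"
  have "\<exists>M\<in>?P. \<forall>X\<in>?P. M \<subseteq> X \<longrightarrow> X = M"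
  proof (rule subset_Zorn_nonempty)
    fix C assume C: "C \<noteq> {}" "subset.chain ?P C"
    then have CP: "G \<in> C \<Longrightarrow> partial_character G" and C1: "G \<in> C \<Longrightarrow> G1 \<subseteq> G"
      and tot: "G \<in> C \<Longrightarrow> H \<in> C \<Longrightarrow> G \<subseteq> H \<or> H \<subseteq> G" for G H
      by (auto simp: subset_chain_def)
    have "partial_character (\<Union>C)"
      unfolding partial_character_def
    proof (intro conjI allI impI)
      show "(0, 1) \<in> \<Union>C" using C(1) partial_characterD(1)[OF CP] by blast
    next
      fix x u y v assume "(x, u) \<in> \<Union>C" "(y, v) \<in> \<Union>C"
      then obtain G where "G \<in> C" "(x, u) \<in> G" "(y, v) \<in> G" using tot by blast
      then show "(x + y, u * v) \<in> \<Union>C" using partial_characterD(2)[OF CP] by blast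
    next
      fix x u assume "(x, u) \<in> \<Union>C"
      then show "(- x, 1 / u) \<in> \<Union>C" "norm u = 1"
        using partial_characterD(3,4)[OF CP] by blast+
    next
      fix u assume "(0, u) \<in> \<Union>C"
      then show "u = 1" using partial_characterD(5)[OF CP] by blast
    qed
    then show "\<Union>C \<in> ?P" using C(1) C1 by blast
  qed (use G1 in blast)
  then obtain M where MP: "M \<in> ?P" and MX: "\<forall>X\<in>?P. M \<subseteq> X \<longrightarrow> X = M" by (rule bexE)
  then have M: "partial_character M" "G1 \<subseteq> M" by auto
  have max: "X = M" if "partial_character X" "M \<subseteq> X" for X
    using MX[rule_format, of X] that M(2) by simp
  have "\<exists>u. (x, u) \<in> M" for x
  proof (rule ccontr)
    assume "\<not> ?thesis"
    then obtain u X where "partial_character X" "M \<subseteq> X" "(x, u) \<in> X"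
      using partial_character_extend[OF M(1), of x] by blast
    then have "X = M" by (intro max)
    with \<open>(x, u) \<in> X\<close> \<open>\<not> ?thesis\<close> show False by blast
  qed
  then obtain c where c: "\<And>x. (x, c x) \<in> M" by metis
  have uniq: "u = v" if "(x, u) \<in> M" "(x, v) \<in> M" for x u v
  proof -
    have "(x - x, u / v) \<in> M" using that by (rule partial_characterD(6)[OF M(1)])
    then have "u / v = 1" using partial_characterD(5)[OF M(1), of "u / v"] by simp
    then show ?thesis by (simp add: divide_eq_1_iff)
  qed
  have "c (x + y) = c x * c y" for x y
    by (rule uniq[OF c]) (rule partial_characterD(2)[OF M(1) c c])
  moreover have "norm (c x) = 1" for x by (rule partial_characterD(4)[OF M(1) c])
  ultimately have "c \<in> characters" by (simp add: dual_group_def)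
  moreover have "c a = w" using uniq[OF c, of a w] G1 M by blast
  ultimately show ?thesis using w by blast
qed


section \<open>Haar measure\<close>

locale haar_dual =
  fixes \<omega> :: "('n::ab_group_add \<Rightarrow> complex) measure"
  assumes haar: "normalized_haar_measure dual_group dual_topology \<omega>"
begin

lemma space_haar: "space \<omega> = characters"
  and sets_haar: "sets \<omega> = sigma_sets characters {U. openin dual_topology U}"
  and emeasure_characters: "emeasure \<omega> characters = 1"
  and emeasure_translate: "g \<in> characters \<Longrightarrow> A \<in> sets \<omega> \<Longrightarrow> emeasure \<omega> (g <#\<^bsub>dual_group\<^esub> A) = emeasure \<omega> A"
  and inner_regular: "A \<in> sets \<omega> \<Longrightarrow> emeasure \<omega> A =
    (SUP C\<in>{C. compactin dual_topology C \<and> closedin dual_topology C \<and> C \<subseteq> A}. emeasure \<omega> C)"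
  using haar by (auto simp: normalized_haar_measure_def)

sublocale finite_measure \<omega>
  by (rule finite_measureI) (simp add: space_haar emeasure_characters)

lemma measure_characters: "measure \<omega> characters = 1"
  by (simp add: measure_def emeasure_characters)

lemma open_Int_in_sets: "open U \<Longrightarrow> U \<inter> characters \<in> sets \<omega>"
  unfolding sets_haar by (rule sigma_sets.Basic) (auto simp: dual_topology_def openin_open)

lemma closed_in_sets:
  assumes "closed C" "C \<subseteq> characters" shows "C \<in> sets \<omega>"
proof -
  have "space \<omega> - (- C \<inter> characters) \<in> sets \<omega>"
    using assms by (intro sets.compl_sets open_Int_in_sets) auto
  moreover have "space \<omega> - (- C \<inter> characters) = C" using assms by (auto simp: space_haar)
  ultimately show ?thesis by simp
qed

lemma compact_in_sets: "compact C \<Longrightarrow> C \<subseteq> characters \<Longrightarrow> C \<in> sets \<omega>"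
  by (intro closed_in_sets compact_imp_closed_functions)

lemma continuous_measurable:
  fixes f :: "('n \<Rightarrow> complex) \<Rightarrow> 'b::topological_space"
  assumes "continuous_on characters f" shows "f \<in> borel_measurable \<omega>"
proof (rule borel_measurableI)
  fix S :: "'b set" assume "open S"
  then obtain U where "open U" "U \<inter> characters = f -` S \<inter> characters"
    using assms unfolding continuous_on_open_invariant by blast
  then show "f -` S \<inter> space \<omega> \<in> sets \<omega>" using open_Int_in_sets[of U] by (simp add: space_haar)
qed

lemma continuous_integrable:
  fixes f :: "('n \<Rightarrow> complex) \<Rightarrow> 'b::{banach, second_countable_topology}"
  assumes "continuous_on characters f" shows "integrable \<omega> f"
proof -
  have "bounded (f ` characters)"
    by (intro compact_imp_bounded compact_continuous_image assms compact_characters)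
  then obtain B where "\<forall>c\<in>characters. norm (f c) \<le> B" by (auto simp: bounded_iff)
  then show ?thesis
    by (intro integrable_const_bound[of _ B] continuous_measurable assms) (auto simp: space_haar)
qed

lemma measurable_continuous_map:
  fixes T :: "('n \<Rightarrow> complex) \<Rightarrow> 'n \<Rightarrow> complex"
  assumes "continuous_on characters T" "T ` characters \<subseteq> characters"
  shows "T \<in> measurable \<omega> \<omega>"
proof (rule measurable_sigma_sets[OF sets_haar])
  show "{U. openin dual_topology U} \<subseteq> Pow characters"
    by (auto simp: dual_topology_def dest: openin_imp_subset)
  show "T \<in> space \<omega> \<rightarrow> characters" using assms by (auto simp: space_haar)
  fix U :: "('n \<Rightarrow> complex) set" assume "U \<in> {U. openin dual_topology U}"
  then obtain V where V: "open V" "U = characters \<inter> V" by (auto simp: dual_topology_def openin_open)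
  obtain W where "open W" "W \<inter> characters = T -` V \<inter> characters"
    using V assms(1) unfolding continuous_on_open_invariant by blast
  moreover have "T -` U \<inter> space \<omega> = T -` V \<inter> characters" using V assms(2) by (auto simp: space_haar)
  ultimately show "T -` U \<inter> space \<omega> \<in> sets \<omega>" using open_Int_in_sets by metis
qed

lemma continuous_char_mult: "continuous_on X (char_mult g)"
  by (rule continuous_into_functions) (auto simp: char_mult_def intro!: continuous_intros continuous_evaluation)

lemma continuous_comp: "continuous_on X (\<lambda>c :: 'n \<Rightarrow> complex. c \<circ> g)"
  by (rule continuous_into_functions) (auto simp: o_def intro!: continuous_evaluation)

lemma char_mult_measurable: "g \<in> characters \<Longrightarrow> char_mult g \<in> measurable \<omega> \<omega>"
  by (rule measurable_continuous_map[OF continuous_char_mult]) (auto intro: char_mult_in)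

lemma translation_invariant:
  assumes g: "g \<in> characters" shows "distr \<omega> \<omega> (char_mult g) = \<omega>"
proof (rule measure_eqI)
  fix A assume "A \<in> sets (distr \<omega> \<omega> (char_mult g))"
  then have A: "A \<in> sets \<omega>" by simp
  let ?B = "char_mult g -` A \<inter> space \<omega>"
  have B: "?B \<in> sets \<omega>" by (rule measurable_sets[OF char_mult_measurable[OF g] A])
  have AK: "A \<subseteq> characters" using sets.sets_into_space[OF A] by (simp add: space_haar)
  have "char_mult g ` ?B = A"
  proof
    show "A \<subseteq> char_mult g ` ?B"
    proof
      fix c assume c: "c \<in> A"
      define d where "d = char_mult (\<lambda>a. cnj (g a)) c"
      have "(\<lambda>a. cnj (g a)) \<in> characters" using g by (auto simp: dual_group_def)
      then have "d \<in> characters" using c AK by (auto simp: d_def intro: char_mult_in)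
      moreover have "char_mult g d = c"
      proof
        fix a
        have "g a * cnj (g a) = 1"
          using complex_norm_square[of "g a"] character_norm[OF g, of a] by simp
        then show "char_mult g d a = c a" by (simp add: char_mult_def d_def flip: mult.assoc)
      qed
      ultimately show "c \<in> char_mult g ` ?B" using c by (auto simp: space_haar intro!: image_eqI[of _ _ d])
    qed
  qed auto
  moreover have "g <#\<^bsub>dual_group\<^esub> ?B = char_mult g ` ?B"
    by (auto simp: l_coset_def dual_group_def char_mult_def[abs_def])
  ultimately show "emeasure (distr \<omega> \<omega> (char_mult g)) A = emeasure \<omega> A"
    using emeasure_translate[OF g B] by (simp add: emeasure_distr char_mult_measurable g A)
qed simp

text \<open>Translation by a character \<open>g\<close> multiplies the integral by
  \<open>g a\<close>; for \<open>a \<noteq> 0\<close> some \<open>g\<close> has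
  \<open>g a \<noteq> 1\<close>.\<close>

lemma integral_character: "(LINT c|\<omega>. c a) = (if a = 0 then 1 else 0)"
proof (cases "a = 0")
  case True
  have "(LINT c|\<omega>. c a) = (LINT c|\<omega>. 1)"
    by (rule Bochner_Integration.integral_cong) (auto simp: True character_zero space_haar)
  then show ?thesis by (simp add: True space_haar measure_characters)
next
  case False
  then obtain g where g: "g \<in> characters" "g a \<noteq> 1" using characters_separate_points by blast
  have m: "(\<lambda>c. c a) \<in> borel_measurable \<omega>" by (intro continuous_measurable continuous_evaluation)
  have "(LINT c|\<omega>. c a) = (LINT c|distr \<omega> \<omega> (char_mult g). c a)"
    by (simp only: translation_invariant[OF g(1)])
  also have "\<dots> = (LINT c|\<omega>. char_mult g c a)"
    by (rule integral_distr[OF char_mult_measurable[OF g(1)] m])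
  also have "\<dots> = g a * (LINT c|\<omega>. c a)" by (simp add: char_mult_def)
  finally show ?thesis using g(2) False by simp
qed

lemma trig_poly_integrable: "trig_poly p \<Longrightarrow> integrable \<omega> p"
  by (intro continuous_integrable trig_poly_continuous)

lemma trig_poly_comp:
  assumes "\<And>a b. g (a + b) = g a + g b" "trig_poly p" shows "trig_poly (\<lambda>c. p (c \<circ> g))"
  using assms(2)
proof induction
  case (monomial k a)
  then show ?case using trig_poly.monomial[of k "g a"] by simp
next
  case (cong p q)
  show ?case
    by (rule trig_poly.cong[OF cong.IH]) (rule cong.hyps(2)[OF characters_comp[OF _ assms(1)]])
qed (rule trig_poly.add)

text \<open>Composition with \<open>g\<close> turns the frequency \<open>a\<close> into
  \<open>g a\<close>, and injectivity ensures that only 0 becomes 0.\<close>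

lemma integral_trig_poly_comp:
  assumes g: "\<And>a b. g (a + b) = g a + g b" "inj g" and "trig_poly p"
  shows "(LINT c|\<omega>. p (c \<circ> g)) = (LINT c|\<omega>. p c)"
  using assms(3)
proof induction
  case (monomial k a)
  have g0: "g 0 = 0" using g(1)[of 0 0] by simp
  have "g a = 0 \<longleftrightarrow> a = 0" using injD[OF g(2), of a 0] g0 by auto
  then show ?case by (simp add: integral_character)
next
  case (add p q)
  have "(LINT c|\<omega>. p (c \<circ> g) + q (c \<circ> g)) = (LINT c|\<omega>. p (c \<circ> g)) + (LINT c|\<omega>. q (c \<circ> g))"
    by (intro Bochner_Integration.integral_add trig_poly_integrable trig_poly_comp[OF g(1)] add.hyps)
  also have "\<dots> = (LINT c|\<omega>. p c + q c)"
    unfolding add.IH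
    by (intro Bochner_Integration.integral_add[symmetric] trig_poly_integrable add.hyps)
  finally show ?case .
next
  case (cong p q)
  have "(LINT c|\<omega>. q (c \<circ> g)) = (LINT c|\<omega>. p (c \<circ> g))"
    by (intro Bochner_Integration.integral_cong refl cong.hyps(2)[symmetric] characters_comp g(1))
      (simp add: space_haar)
  also have "\<dots> = (LINT c|\<omega>. p c)" by (rule cong.IH)
  also have "\<dots> = (LINT c|\<omega>. q c)"
    by (intro Bochner_Integration.integral_cong refl cong.hyps(2)) (simp add: space_haar)
  finally show ?case .
qed

section \<open>Approximation of Borel sets and invariance under automorphisms\<close>

lemma inner_compact:
  assumes A: "A \<in> sets \<omega>" and "e > 0"
  shows "\<exists>C. compact C \<and> C \<subseteq> A \<and> measure \<omega> A < measure \<omega> C + e"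
proof (cases "measure \<omega> A < e")
  case True
  then show ?thesis by (intro exI[of _ "{}"]) simp
next
  case False
  with \<open>e > 0\<close> have "ennreal (measure \<omega> A - e) < emeasure \<omega> A"
    unfolding emeasure_eq_measure by (intro ennreal_lessI) auto
  then obtain C where C: "compactin dual_topology C" "C \<subseteq> A" "ennreal (measure \<omega> A - e) < emeasure \<omega> C"
    unfolding inner_regular[OF A] less_SUP_iff by auto
  then have "measure \<omega> A - e < measure \<omega> C"
    unfolding emeasure_eq_measure using False by (simp add: ennreal_less_iff)
  with C show ?thesis
    by (intro exI[of _ C]) (auto simp: dual_topology_def compactin_subtopology)
qed

text \<open>The error is at most \<open>e\<close> where \<open>T c\<close> lies in \<open>C\<close>
  or \<open>D\<close>, and at most 1 on the remaining set of measure at most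
  \<open>2 * e\<close>.\<close>

lemma approx_indicator:
  assumes A: "A \<in> sets \<omega>" and "compact C" "C \<subseteq> characters" "compact D" "D \<subseteq> characters"
    and T: "T \<in> measurable \<omega> \<omega>" and f: "f \<in> borel_measurable \<omega>"
    and CA: "\<And>c. c \<in> characters \<Longrightarrow> T c \<in> C \<Longrightarrow> T c \<in> A" and DA: "\<And>c. c \<in> characters \<Longrightarrow> T c \<in> D \<Longrightarrow> T c \<notin> A"
    and f01: "\<And>c. c \<in> characters \<Longrightarrow> 0 \<le> f c \<and> f c \<le> 1" and "e > 0"
    and fC: "\<And>c. c \<in> C \<Longrightarrow> 1 - f c \<le> e" and fD: "\<And>c. c \<in> D \<Longrightarrow> f c \<le> e"
    and small: "measure \<omega> (characters - (T -` C \<union> T -` D)) \<le> 2 * e"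
  shows "(LINT c|\<omega>. \<bar>indicator A (T c) - f (T c)\<bar>) \<le> 3 * e"
proof -
  have TK: "T c \<in> characters" if "c \<in> characters" for c
    using measurable_space[OF T] that by (simp add: space_haar)
  let ?E = "characters - (T -` C \<union> T -` D)"
  have Tin: "T -` X \<inter> characters \<in> sets \<omega>" if "X \<in> sets \<omega>" for X
    using measurable_sets[OF T that] by (simp add: space_haar)
  have "?E = space \<omega> - ((T -` C \<inter> characters) \<union> (T -` D \<inter> characters))" by (auto simp: space_haar)
  also have "\<dots> \<in> sets \<omega>" using assms by (intro sets.compl_sets sets.Un Tin compact_in_sets)
  finally have E: "?E \<in> sets \<omega>" .
  have pw: "\<bar>indicator A (T c) - f (T c)\<bar> \<le> e + indicator ?E c" if "c \<in> characters" for c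
    using CA[OF that] DA[OF that] f01[OF TK[OF that]] fC[of "T c"] fD[of "T c"] that \<open>e > 0\<close>
    by (auto simp: indicator_def)
  have m1: "(\<lambda>c. \<bar>indicator A (T c) - f (T c)\<bar>) \<in> borel_measurable \<omega>"
    using T f A by measurable
  have "(LINT c|\<omega>. \<bar>indicator A (T c) - f (T c)\<bar>) \<le> (LINT c|\<omega>. e + indicator ?E c)"
  proof (rule integral_mono)
    show "integrable \<omega> (\<lambda>c. \<bar>indicator A (T c) - f (T c)\<bar>)"
      using f01[OF TK] by (intro integrable_const_bound[OF _ m1, of 1]) (auto simp: space_haar indicator_def)
    show "integrable \<omega> (\<lambda>c. e + indicator ?E c)" using E by (auto simp: emeasure_eq_measure)
  qed (use pw in \<open>simp add: space_haar\<close>)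
  also have "\<dots> = e + measure \<omega> ?E"
    using E by (simp add: space_haar measure_characters emeasure_eq_measure Int_absorb2)
  also have "\<dots> \<le> 3 * e" using small by simp
  finally show ?thesis .
qed

text \<open>One trigonometric polynomial approximates both the indicator of \<open>A\<close> and its composition with a
  homeomorphism \<open>T\<close>; this is what lets the invariance of \<open>\<omega>\<close> under automorphisms be read off the
  integrals of trigonometric polynomials.\<close>

lemma approx_indicator_pair:
  assumes A: "A \<in> sets \<omega>" and e: "0 < e" "e < 1"
    and cont: "continuous_on characters (T :: ('n \<Rightarrow> complex) \<Rightarrow> 'n \<Rightarrow> complex)" and T: "bij_betw T characters characters"
  obtains f :: "('n \<Rightarrow> complex) \<Rightarrow> real" where "trig_poly (\<lambda>c. of_real (f c))"
    "\<And>c. c \<in> characters \<Longrightarrow> 0 \<le> f c \<and> f c \<le> 1"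
    "(LINT c|\<omega>. \<bar>indicator A c - f c\<bar>) \<le> 3 * e"
    "(LINT c|\<omega>. \<bar>indicator A (T c) - f (T c)\<bar>) \<le> 3 * e"
proof -
  have TK: "T ` characters = characters"
    using T by (auto simp: bij_betw_def)
  have Tm: "T \<in> measurable \<omega> \<omega>" using cont TK by (intro measurable_continuous_map) auto
  have AK: "A \<subseteq> characters" using sets.sets_into_space[OF A] by (simp add: space_haar)
  let ?B = "characters - A" and ?A' = "T -` A \<inter> characters" and ?B' = "T -` (characters - A) \<inter> characters"
  have B: "?B \<in> sets \<omega>" using sets.compl_sets[OF A] by (simp add: space_haar)
  have A': "?A' \<in> sets \<omega>" and B': "?B' \<in> sets \<omega>"
    using measurable_sets[OF Tm A] measurable_sets[OF Tm B] by (simp_all add: space_haar)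
  obtain C where C: "compact C" "C \<subseteq> A" "measure \<omega> A < measure \<omega> C + e"
    using inner_compact[OF A e(1)] by blast
  obtain D where D: "compact D" "D \<subseteq> ?B" "measure \<omega> ?B < measure \<omega> D + e"
    using inner_compact[OF B e(1)] by blast
  obtain C' where C': "compact C'" "C' \<subseteq> ?A'" "measure \<omega> ?A' < measure \<omega> C' + e"
    using inner_compact[OF A' e(1)] by blast
  obtain D' where D': "compact D'" "D' \<subseteq> ?B'" "measure \<omega> ?B' < measure \<omega> D' + e"
    using inner_compact[OF B' e(1)] by blast
  have K: "C \<subseteq> characters" "D \<subseteq> characters" "C' \<subseteq> characters" "D' \<subseteq> characters"
    using AK C D C' D' by auto
  have cT: "compact (T ` C')" "compact (T ` D')"
    using C' D' K by (auto intro!: compact_continuous_image continuous_on_subset[OF cont])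
  \<comment> \<open>\<open>C\<close> and \<open>D\<close> approximate \<open>A\<close> and its
    complement, \<open>C'\<close> and \<open>D'\<close> their preimages; moving the latter forward
    by \<open>T\<close> lets one \<open>f\<close> serve both estimates.\<close>
  let ?C = "C \<union> T ` C'" and ?D = "D \<union> T ` D'"
  have comp: "compact ?C" "compact ?D" using C D cT by auto
  have sub: "?C \<subseteq> A" "?D \<subseteq> characters - A" using C D C' D' by auto
  then have subK: "?C \<subseteq> characters" "?D \<subseteq> characters" using AK by auto
  have disj: "?D \<inter> ?C = {}" using sub by blast
  obtain f where f: "trig_poly (\<lambda>c. of_real (f c))" "\<And>c. c \<in> characters \<Longrightarrow> 0 \<le> f c \<and> f c \<le> 1"
    "\<And>c. c \<in> ?D \<Longrightarrow> f c < e" "\<And>c. c \<in> ?C \<Longrightarrow> f c > 1 - e"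
    by (rule trig_poly_separates_sets[OF comp(2) subK(2) comp(1) subK(1) disj e], rule that)
  have fm: "f \<in> borel_measurable \<omega>"
    using continuous_on_Re[OF trig_poly_continuous[OF f(1)]] by (intro continuous_measurable) simp
  have S: "C \<in> sets \<omega>" "D \<in> sets \<omega>" "C' \<in> sets \<omega>" "D' \<in> sets \<omega>"
    using K C D C' D' by (auto intro: compact_in_sets)
  have small: "measure \<omega> (characters - (X \<union> Y)) \<le> 2 * e"
    if "X \<in> sets \<omega>" "Y \<in> sets \<omega>" "P \<in> sets \<omega>" "Q \<in> sets \<omega>" "X \<subseteq> P" "Y \<subseteq> Q" "P \<inter> Q = {}" "P \<union> Q = characters"
      "measure \<omega> P < measure \<omega> X + e" "measure \<omega> Q < measure \<omega> Y + e" for X Y P Q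
  proof -
    have "measure \<omega> (X \<union> Y) = measure \<omega> X + measure \<omega> Y"
      using that by (intro finite_measure_Union) auto
    moreover have "measure \<omega> (P \<union> Q) = measure \<omega> P + measure \<omega> Q"
      using that by (intro finite_measure_Union) auto
    moreover have "measure \<omega> (characters - (X \<union> Y)) = measure \<omega> characters - measure \<omega> (X \<union> Y)"
      using finite_measure_compl[of "X \<union> Y"] that by (simp add: space_haar)
    ultimately show ?thesis using that(8-10) by simp
  qed
  have fC: "1 - f c \<le> e" if "c \<in> ?C" for c using f(4)[OF that] by simp
  have fD: "f c \<le> e" if "c \<in> ?D" for c using f(3)[OF that] by simp
  show ?thesis
  proof (rule that[OF f(1,2)])
    have "measure \<omega> (characters - (?C \<union> ?D)) \<le> measure \<omega> (characters - (C \<union> D))"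
      using S by (intro finite_measure_mono) (auto simp flip: space_haar)
    also have "\<dots> \<le> 2 * e" using S A B C D AK by (intro small[of C D A ?B]) auto
    finally have "measure \<omega> (characters - ((\<lambda>c. c) -` ?C \<union> (\<lambda>c. c) -` ?D)) \<le> 2 * e" by simp
    then show "(LINT c|\<omega>. \<bar>indicator A c - f c\<bar>) \<le> 3 * e"
      using sub by (intro approx_indicator[OF A comp(1) subK(1) comp(2) subK(2) _ fm _ _ f(2) e(1) fC fD,
            where T = "\<lambda>c. c"]) (simp_all, blast+)
    have "measure \<omega> (characters - (T -` ?C \<union> T -` ?D)) \<le> measure \<omega> (characters - (C' \<union> D'))"
      using S K by (intro finite_measure_mono) (auto simp flip: space_haar)
    also have "\<dots> \<le> 2 * e" using S A' B' C' D' TK by (intro small[of C' D' ?A' ?B']) auto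
    finally show "(LINT c|\<omega>. \<bar>indicator A (T c) - f (T c)\<bar>) \<le> 3 * e"
      by (rule approx_indicator[OF A comp(1) subK(1) comp(2) subK(2) Tm fm _ _ f(2) e(1) fC fD, rotated -1])
        (use sub in blast)+
  qed
qed

lemma bij_betw_comp:
  assumes g: "\<And>a b :: 'n. g (a + b) = g a + g b" "bij g"
  shows "bij_betw (\<lambda>c. c \<circ> g) characters characters"
proof (rule bij_betw_byWitness[where f' = "\<lambda>c. c \<circ> inv_into UNIV g"])
  have "inv_into UNIV g (a + b) = inv_into UNIV g a + inv_into UNIV g b" for a b
    using g by (metis bij_inv_eq_iff)
  then show "(\<lambda>c. c \<circ> inv_into UNIV g) ` characters \<subseteq> characters"
    by (auto simp: dual_group_def)
  show "(\<lambda>c. c \<circ> g) ` characters \<subseteq> characters" using g(1) by (auto simp: dual_group_def)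
qed (use g(2) in \<open>auto simp: fun_eq_iff bij_is_surj surj_f_inv_f bij_is_inj inv_f_f\<close>)

lemma automorphism_measurable:
  assumes "\<And>a b :: 'n. g (a + b) = g a + g b"
  shows "(\<lambda>c. c \<circ> g) \<in> measurable \<omega> \<omega>"
  by (rule measurable_continuous_map[OF continuous_comp]) (use assms in \<open>auto simp: dual_group_def\<close>)

lemma indicator_integral_close:
  assumes "A \<in> sets \<omega>" "T \<in> measurable \<omega> \<omega>" "integrable \<omega> (\<lambda>c. f (T c))"
    "(LINT c|\<omega>. \<bar>indicator A (T c) - f (T c)\<bar>) \<le> r"
  shows "\<bar>measure \<omega> (T -` A \<inter> space \<omega>) - (LINT c|\<omega>. f (T c))\<bar> \<le> (r :: real)"
proof -
  have S: "T -` A \<inter> space \<omega> \<in> sets \<omega>" using assms measurable_sets by blast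
  have eq: "(LINT c|\<omega>. indicator A (T c)) = measure \<omega> (T -` A \<inter> space \<omega>)"
  proof -
    have "(LINT c|\<omega>. indicator A (T c)) = (LINT c|\<omega>. indicator (T -` A \<inter> space \<omega>) c)"
      by (rule Bochner_Integration.integral_cong) (auto simp: indicator_def)
    also have "\<dots> = measure \<omega> (T -` A \<inter> space \<omega>)" using S by simp
    finally show ?thesis .
  qed
  have int: "integrable \<omega> (\<lambda>c. indicator A (T c) :: real)"
    using assms(1,2) by (intro integrable_const_bound[of _ 1]) (auto simp: indicator_def)
  have "measure \<omega> (T -` A \<inter> space \<omega>) - (LINT c|\<omega>. f (T c)) = (LINT c|\<omega>. indicator A (T c) - f (T c))"
    using int assms(3) by (simp add: eq)
  also have "\<bar>\<dots>\<bar> \<le> (LINT c|\<omega>. \<bar>indicator A (T c) - f (T c)\<bar>)" by (rule integral_abs_bound)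
  finally show ?thesis using assms(4) by simp
qed

lemma integrable_real_trig_poly: "trig_poly (\<lambda>c. of_real (f c)) \<Longrightarrow> integrable \<omega> (f :: _ \<Rightarrow> real)"
  using integrable_Re[OF trig_poly_integrable] by fastforce

text \<open>The measures of \<open>A\<close> and of its preimage are close to the integrals of
  \<open>f\<close> and of \<open>f\<close> after composition with \<open>g\<close>, which
  \<open>integral_trig_poly_comp\<close> identifies.\<close>

theorem automorphism_invariant:
  assumes g: "\<And>a b :: 'n. g (a + b) = g a + g b" "bij g"
  shows "distr \<omega> \<omega> (\<lambda>c. c \<circ> g) = \<omega>"
proof (rule measure_eqI)
  let ?T = "\<lambda>c :: 'n \<Rightarrow> complex. c \<circ> g"
  have Tm: "?T \<in> measurable \<omega> \<omega>" by (rule automorphism_measurable[OF g(1)])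
  fix A assume "A \<in> sets (distr \<omega> \<omega> ?T)"
  then have A: "A \<in> sets \<omega>" by simp
  have "\<bar>measure \<omega> (?T -` A \<inter> space \<omega>) - measure \<omega> A\<bar> \<le> e" if "e > 0" for e
  proof -
    \<comment> \<open>Each of the two approximations costs \<open>3 * e'\<close>; the bound 1/2
      keeps \<open>e'\<close> below 1.\<close>
    define e' where "e' = min (1/2) (e / 6)"
    have e': "0 < e'" "e' < 1" "6 * e' \<le> e" using that by (auto simp: e'_def)
    obtain f where f: "trig_poly (\<lambda>c. of_real (f c))"
      and "\<And>c. c \<in> characters \<Longrightarrow> 0 \<le> f c \<and> f c \<le> 1"
      and f1: "(LINT c|\<omega>. \<bar>indicator A c - f c\<bar>) \<le> 3 * e'"
      and f2: "(LINT c|\<omega>. \<bar>indicator A (?T c) - f (?T c)\<bar>) \<le> 3 * e'"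
      by (rule approx_indicator_pair[OF A e'(1,2) continuous_comp[of _ g] bij_betw_comp[OF g]], rule that)
    have "complex_of_real (LINT c|\<omega>. f (c \<circ> g)) = complex_of_real (LINT c|\<omega>. f c)"
      using integral_trig_poly_comp[OF g(1) bij_is_inj[OF g(2)] f] by simp
    then have eq: "(LINT c|\<omega>. f (c \<circ> g)) = (LINT c|\<omega>. f c)" by (simp only: of_real_eq_iff)
    have "\<bar>measure \<omega> A - (LINT c|\<omega>. f c)\<bar> \<le> 3 * e'"
      using indicator_integral_close[OF A, of "\<lambda>c. c" f] f1 integrable_real_trig_poly[OF f]
        sets.sets_into_space[OF A] by (simp add: Int_absorb2)
    moreover have "\<bar>measure \<omega> (?T -` A \<inter> space \<omega>) - (LINT c|\<omega>. f (c \<circ> g))\<bar> \<le> 3 * e'"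
      using trig_poly_comp[OF g(1) f] f2
      by (intro indicator_integral_close[OF A Tm] integrable_real_trig_poly)
    ultimately show ?thesis using eq e'(3) by linarith
  qed
  then have "\<bar>measure \<omega> (?T -` A \<inter> space \<omega>) - measure \<omega> A\<bar> \<le> 0" by (rule field_le_epsilon[of _ 0, simplified])
  then show "emeasure (distr \<omega> \<omega> ?T) A = emeasure \<omega> A"
    by (simp add: emeasure_distr[OF Tm A] emeasure_eq_measure)
qed simp

end


section \<open>Ergodicity\<close>

lemma funpow_additive:
  fixes g :: "'n::ab_group_add \<Rightarrow> 'n"
  assumes "\<And>a b. g (a + b) = g a + g b"
  shows "(g ^^ k) (a + b) = (g ^^ k) a + (g ^^ k) b"
  by (induction k) (simp_all add: assms)

context haar_dual
begin

text \<open>For monomials of frequencies \<open>a\<close> and \<open>b\<close> the correlation is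
  nonzero only if \<open>a + (g ^^ k) b = 0\<close>. Without periodic points this happens for at
  most one \<open>k\<close> when \<open>b \<noteq> 0\<close>, so the factorisation is eventually
  exact; bilinearity does the rest.\<close>

lemma mixing:
  assumes g: "\<And>a b :: 'n. g (a + b) = g a + g b" "inj g" and per: "periodic_points g \<subseteq> {0}"
    and "trig_poly p" "trig_poly q"
  shows "\<forall>\<^sub>F k in sequentially.
    (LINT c|\<omega>. p c * q (c \<circ> (g ^^ k))) = (LINT c|\<omega>. p c) * (LINT c|\<omega>. q c)"
  using assms(4)
proof induction
  case (monomial l a)
  note gk = funpow_additive[of g, OF g(1)]
  show ?case using assms(5)
  proof induction
    case (monomial m b)
    have int: "(LINT c|\<omega>. l * c a * (m * (c \<circ> (g ^^ k)) b)) = l * m * (if a + (g ^^ k) b = 0 then 1 else 0)" for k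
    proof -
      have "(LINT c|\<omega>. l * c a * (m * (c \<circ> (g ^^ k)) b)) = (LINT c|\<omega>. l * m * c (a + (g ^^ k) b))"
        by (rule Bochner_Integration.integral_cong) (simp_all add: space_haar character_add)
      then show ?thesis by (simp add: integral_character)
    qed
    have "\<forall>\<^sub>F k in sequentially. a + (g ^^ k) b = 0 \<longleftrightarrow> a = 0 \<and> b = 0"
    proof (cases "b = 0")
      case True
      have "(g ^^ k) 0 = 0" for k using gk[of k 0 0] by simp
      with True show ?thesis by simp
    next
      case False
      \<comment> \<open>Two exponents would give the same image of \<open>b\<close>, and injectivity
        would make their difference a period of \<open>b\<close>.\<close>
      have uniq: "k = l" if "a + (g ^^ k) b = 0" "a + (g ^^ l) b = 0" for k l
      proof -
        have "k \<ge> l" if eq: "(g ^^ k) b = (g ^^ l) b" for k l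
        proof (rule ccontr)
          assume "\<not> k \<ge> l"
          then have l: "l = k + (l - k)" "l - k > 0" by simp_all
          have "(g ^^ l) b = (g ^^ k) ((g ^^ (l - k)) b)"
            by (subst l(1)) (simp only: funpow_add o_apply)
          with eq have "(g ^^ k) b = (g ^^ k) ((g ^^ (l - k)) b)" by simp
          with inj_fn[OF g(2), of k] have "(g ^^ (l - k)) b = b" by (metis injD)
          with l(2) have "b \<in> periodic_points g" unfolding periodic_points_def by blast
          with per False show False by blast
        qed
        moreover have "(g ^^ k) b = (g ^^ l) b" using that by (metis add_left_cancel)
        ultimately show ?thesis by (metis le_antisym)
      qed
      have "\<forall>\<^sub>F k in sequentially. a + (g ^^ k) b \<noteq> 0"
      proof (cases "\<exists>l. a + (g ^^ l) b = 0")
        case True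
        then obtain l where "a + (g ^^ l) b = 0" by blast
        with uniq have "a + (g ^^ k) b \<noteq> 0" if "k > l" for k using that by (metis less_irrefl)
        then show ?thesis by (rule eventually_mono[OF eventually_gt_at_top])
      next
        case False
        then show ?thesis by simp
      qed
      then show ?thesis by eventually_elim (use False in simp)
    qed
    then show ?case
    proof eventually_elim
      case (elim k)
      then show ?case unfolding int by (simp add: integral_character)
    qed
  next
    case (add q q')
    have int: "integrable \<omega> (\<lambda>c. l * c a * q (c \<circ> (g ^^ k)))" if "trig_poly q" for q k
      by (rule trig_poly_integrable[OF trig_poly_mult[OF trig_poly.monomial trig_poly_comp[OF gk that]]])
    from add.IH show ?case
    proof eventually_elim
      case (elim k)
      have "(LINT c|\<omega>. l * c a * (q (c \<circ> (g ^^ k)) + q' (c \<circ> (g ^^ k)))) =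
          (LINT c|\<omega>. l * c a * q (c \<circ> (g ^^ k))) + (LINT c|\<omega>. l * c a * q' (c \<circ> (g ^^ k)))"
        unfolding distrib_left by (intro Bochner_Integration.integral_add int add.hyps)
      also have "\<dots> = (LINT c|\<omega>. l * c a) * ((LINT c|\<omega>. q c) + (LINT c|\<omega>. q' c))"
        unfolding elim distrib_left ..
      also have "(LINT c|\<omega>. q c) + (LINT c|\<omega>. q' c) = (LINT c|\<omega>. q c + q' c)"
        by (intro Bochner_Integration.integral_add[symmetric] trig_poly_integrable add.hyps)
      finally show ?case .
    qed
  next
    case (cong q q')
    have "(LINT c|\<omega>. l * c a * q' (c \<circ> (g ^^ k))) = (LINT c|\<omega>. l * c a * q (c \<circ> (g ^^ k)))" for k
      by (intro Bochner_Integration.integral_cong refl arg_cong2[of _ _ _ _ "(*)"]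
          cong.hyps(2)[symmetric] characters_comp gk) (simp add: space_haar)
    moreover have "(LINT c|\<omega>. q' c) = (LINT c|\<omega>. q c)"
      by (intro Bochner_Integration.integral_cong refl cong.hyps(2)[symmetric]) (simp add: space_haar)
    ultimately show ?case using cong.IH by presburger
  qed
next
  case (add p p')
  note gk = funpow_additive[of g, OF g(1)]
  have int: "integrable \<omega> (\<lambda>c. p c * q (c \<circ> (g ^^ k)))" if "trig_poly p" for p k
    by (rule trig_poly_integrable[OF trig_poly_mult[OF that trig_poly_comp[OF gk assms(5)]]])
  from add.IH show ?case
  proof eventually_elim
    case (elim k)
    have "(LINT c|\<omega>. (p c + p' c) * q (c \<circ> (g ^^ k))) =
        (LINT c|\<omega>. p c * q (c \<circ> (g ^^ k))) + (LINT c|\<omega>. p' c * q (c \<circ> (g ^^ k)))"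
      unfolding distrib_right by (intro Bochner_Integration.integral_add int add.hyps)
    also have "\<dots> = ((LINT c|\<omega>. p c) + (LINT c|\<omega>. p' c)) * (LINT c|\<omega>. q c)"
      unfolding elim distrib_right ..
    also have "(LINT c|\<omega>. p c) + (LINT c|\<omega>. p' c) = (LINT c|\<omega>. p c + p' c)"
      by (intro Bochner_Integration.integral_add[symmetric] trig_poly_integrable add.hyps)
    finally show ?case .
  qed
next
  case (cong p p')
  have "(LINT c|\<omega>. p' c * q (c \<circ> (g ^^ k))) = (LINT c|\<omega>. p c * q (c \<circ> (g ^^ k)))" for k
    by (intro Bochner_Integration.integral_cong refl arg_cong2[of _ _ _ _ "(*)"]
        cong.hyps(2)[symmetric]) (simp add: space_haar)
  moreover have "(LINT c|\<omega>. p' c) = (LINT c|\<omega>. p c)"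
    by (intro Bochner_Integration.integral_cong refl cong.hyps(2)[symmetric]) (simp add: space_haar)
  ultimately show ?case using cong.IH by presburger
qed

text \<open>Both \<open>f\<close> and its composition with a power of the map approximate the
  indicator of the invariant set \<open>A\<close>, so their correlation is close to the measure of
  \<open>A\<close>. By \<open>mixing\<close> it is also the square of the integral of
  \<open>f\<close>, hence the measure equals its own square.\<close>

theorem measure_invariant_set:
  assumes g: "\<And>a b :: 'n. g (a + b) = g a + g b" "bij g" and per: "periodic_points g \<subseteq> {0}"
    and A: "A \<in> sets \<omega>" and inv: "\<And>c. c \<in> characters \<Longrightarrow> c \<circ> g \<in> A \<longleftrightarrow> c \<in> A"
  shows "measure \<omega> A \<in> {0, 1}"
proof -
  let ?\<mu> = "measure \<omega> A"
  have gk: "(g ^^ k) (a + b) = (g ^^ k) a + (g ^^ k) b" "bij (g ^^ k)" for k a b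
    using funpow_additive[of g, OF g(1)] g(2) by (auto simp: bij_fn)
  have invk: "c \<circ> (g ^^ k) \<in> A \<longleftrightarrow> c \<in> A" if "c \<in> characters" for c k
  proof (induction k)
    case (Suc k)
    have "(c \<circ> (g ^^ k)) \<circ> g \<in> A \<longleftrightarrow> c \<circ> (g ^^ k) \<in> A"
      by (rule inv, rule characters_comp[OF that gk(1)])
    moreover have "c \<circ> (g ^^ Suc k) = (c \<circ> (g ^^ k)) \<circ> g" by (simp only: funpow_Suc_right o_assoc)
    ultimately show ?case using Suc by (simp only:)
  qed simp
  have "\<bar>?\<mu> - ?\<mu>\<^sup>2\<bar> \<le> d" if "d > 0" for d
  proof -
    \<comment> \<open>Comparing the correlation with the measure costs \<open>6 * e\<close>, and
      replacing the squared integral by the squared measure another \<open>6 * e\<close>.\<close>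
    define e where "e = min (1/2) (d / 12)"
    have e: "0 < e" "e < 1" "12 * e \<le> d" using that by (auto simp: e_def)
    obtain f where f: "trig_poly (\<lambda>c. of_real (f c))" and f01: "\<And>c. c \<in> characters \<Longrightarrow> 0 \<le> f c \<and> f c \<le> 1"
      and f1: "(LINT c|\<omega>. \<bar>indicator A c - f c\<bar>) \<le> 3 * e"
      and "(LINT c|\<omega>. \<bar>indicator A c - f c\<bar>) \<le> 3 * e"
      by (rule approx_indicator_pair[OF A e(1,2), of "\<lambda>c. c"], simp, simp add: bij_betw_def, rule that)
    let ?I = "LINT c|\<omega>. f c"
    obtain k where k: "(LINT c|\<omega>. of_real (f c) * of_real (f (c \<circ> (g ^^ k)))) =
        (LINT c|\<omega>. complex_of_real (f c)) * (LINT c|\<omega>. complex_of_real (f c))"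
      using eventually_happens[OF mixing[OF g(1) bij_is_inj[OF g(2)] per f f]] by auto
    let ?T = "\<lambda>c :: 'n \<Rightarrow> complex. c \<circ> (g ^^ k)"
    have Tm: "?T \<in> measurable \<omega> \<omega>" by (rule automorphism_measurable[OF gk(1)])
    have fm: "f \<in> borel_measurable \<omega>" using integrable_real_trig_poly[OF f] by simp
    have Tin: "?T c \<in> characters" if "c \<in> characters" for c by (rule characters_comp[OF that gk(1)])
    have "complex_of_real (LINT c|\<omega>. f c * f (?T c)) = complex_of_real (?I * ?I)"
      using k by (simp only: integral_complex_of_real flip: of_real_mult)
    then have II: "(LINT c|\<omega>. f c * f (?T c)) = ?I * ?I" by (simp only: of_real_eq_iff)
    have b1: "integrable \<omega> h" if "h \<in> borel_measurable \<omega>" "\<And>c. c \<in> characters \<Longrightarrow> \<bar>h c\<bar> \<le> 1"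
      for h :: "_ \<Rightarrow> real" using that by (intro integrable_const_bound[of _ 1]) (auto simp: space_haar)
    have fTm: "(\<lambda>c. f (?T c)) \<in> borel_measurable \<omega>" by (rule measurable_compose[OF Tm fm])
    have i1: "integrable \<omega> (\<lambda>c. \<bar>indicator A c - f c\<bar>)"
      using A fm f01 by (intro b1) (auto simp: indicator_def)
    have i2: "integrable \<omega> (\<lambda>c. \<bar>indicator A c - f (?T c)\<bar>)"
      using A fTm f01[OF Tin] by (intro b1) (auto simp: indicator_def)
    have i3: "integrable \<omega> (\<lambda>c. f c * f (?T c))"
      using fm fTm f01 f01[OF Tin] by (intro b1) (auto simp: abs_mult intro!: mult_le_one)
    have i4: "integrable \<omega> (indicator A :: _ \<Rightarrow> real)" using A by (intro b1) (auto simp: indicator_def)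
    \<comment> \<open>Invariance of \<open>A\<close> moves \<open>?T\<close> into the indicator as
      well, after which a change of variables returns the error of \<open>f\<close> itself.\<close>
    have "(LINT c|\<omega>. \<bar>indicator A c - f (?T c)\<bar>) = (LINT c|\<omega>. \<bar>indicator A (?T c) - f (?T c)\<bar>)"
      by (rule Bochner_Integration.integral_cong) (auto simp: space_haar indicator_def invk)
    also have "\<dots> = (LINT c|distr \<omega> \<omega> ?T. \<bar>indicator A c - f c\<bar>)"
      by (rule integral_distr[OF Tm, symmetric]) (use A fm in measurable)
    also have "\<dots> \<le> 3 * e" using f1 by (simp only: automorphism_invariant[OF gk])
    finally have f2: "(LINT c|\<omega>. \<bar>indicator A c - f (?T c)\<bar>) \<le> 3 * e" .
    have pw: "\<bar>indicator A c - f c * f (?T c)\<bar> \<le> \<bar>indicator A c - f c\<bar> + \<bar>indicator A c - f (?T c)\<bar>"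
      if "c \<in> characters" for c
    proof -
      define x :: real where "x = indicator A c"
      have x: "x * x = x" "0 \<le> x" "x \<le> 1" by (auto simp: x_def indicator_def)
      have "x - f c * f (?T c) = x * (x - f (?T c)) + f (?T c) * (x - f c)"
        by (simp add: algebra_simps x(1))
      also have "\<bar>\<dots>\<bar> \<le> \<bar>x * (x - f (?T c))\<bar> + \<bar>f (?T c) * (x - f c)\<bar>" by (rule abs_triangle_ineq)
      also have "\<dots> \<le> 1 * \<bar>x - f (?T c)\<bar> + 1 * \<bar>x - f c\<bar>"
        unfolding abs_mult using x f01[OF Tin[OF that]] by (intro add_mono mult_right_mono) auto
      finally show ?thesis by (simp add: x_def)
    qed
    have mA: "?\<mu> = (LINT c|\<omega>. indicator A c)" using A sets.sets_into_space[OF A] by (simp add: Int_absorb2)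
    have "?\<mu> - ?I * ?I = (LINT c|\<omega>. indicator A c - f c * f (?T c))"
      unfolding mA II[symmetric] using i3 i4 by simp
    also have "\<bar>\<dots>\<bar> \<le> (LINT c|\<omega>. \<bar>indicator A c - f c * f (?T c)\<bar>)" by (rule integral_abs_bound)
    also have "\<dots> \<le> (LINT c|\<omega>. \<bar>indicator A c - f c\<bar> + \<bar>indicator A c - f (?T c)\<bar>)"
      using i1 i2 i3 i4 pw by (intro integral_mono) (auto simp: space_haar)
    also have "\<dots> \<le> 6 * e" using f1 f2 i1 i2 by simp
    finally have B1: "\<bar>?\<mu> - ?I * ?I\<bar> \<le> 6 * e" .
    have If: "integrable \<omega> f" by (rule integrable_real_trig_poly[OF f])
    have "?\<mu> - ?I = (LINT c|\<omega>. indicator A c - f c)" unfolding mA using i4 If by simp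
    also have "\<bar>\<dots>\<bar> \<le> (LINT c|\<omega>. \<bar>indicator A c - f c\<bar>)" by (rule integral_abs_bound)
    finally have B2: "\<bar>?\<mu> - ?I\<bar> \<le> 3 * e" using f1 by simp
    have I01: "0 \<le> ?I" "?I \<le> 1"
    proof -
      show "0 \<le> ?I" using f01 by (intro Bochner_Integration.integral_nonneg_AE) (auto simp: space_haar)
      have "?I \<le> (LINT c|\<omega>. 1)" using f01 If by (intro integral_mono) (auto simp: space_haar)
      then show "?I \<le> 1" by (simp add: space_haar measure_characters)
    qed
    have \<mu>1: "?\<mu> \<le> 1" using bounded_measure[of A] by (simp add: space_haar measure_characters)
    have "\<bar>?\<mu> * ?\<mu> - ?I * ?I\<bar> = \<bar>?\<mu> + ?I\<bar> * \<bar>?\<mu> - ?I\<bar>"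
      by (simp add: abs_mult[symmetric] algebra_simps)
    also have "\<dots> \<le> 2 * (3 * e)" using I01 \<mu>1 B2 by (intro mult_mono) auto
    finally show ?thesis using B1 e(3) unfolding power2_eq_square by linarith
  qed
  then have "\<bar>?\<mu> - ?\<mu>\<^sup>2\<bar> \<le> 0" by (rule field_le_epsilon[of _ 0, simplified])
  then have "?\<mu> * (1 - ?\<mu>) = 0" by (simp add: power2_eq_square algebra_simps)
  then show ?thesis by auto
qed

section \<open>Ergodicity against periodic points and finite invariant sets\<close>

lemma dual_aut_bij:
  assumes g: "\<And>a b :: 'n. g (a + b) = g a + g b" "bij g"
  shows "bij_betw (dual_aut g) characters characters"
  using dual_aut_in_auto[OF g(2,1)] by (auto simp: auto_def Bij_def)

text \<open>The power with exponent 1 is \<open>dual_aut g\<close>, the inverse of composition with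
  \<open>g\<close> on characters, so invariance of \<open>A\<close> takes the form used by
  \<open>measure_invariant_set\<close>.\<close>

theorem ergodic_automorphism_if_aperiodic:
  assumes g: "\<And>a b :: 'n. g (a + b) = g a + g b" "bij g" and per: "periodic_points g \<subseteq> {0}"
  shows "ergodic_automorphism dual_group \<omega> (dual_aut g)"
  unfolding ergodic_automorphism_def ergodic_action_def
proof (intro ballI impI)
  fix A assume A: "A \<in> sets \<omega>"
    and inv: "\<forall>h\<in>{dual_aut g [^]\<^bsub>AutoGroup dual_group\<^esub> n |n :: int. True}. h ` A = A"
  have "group (AutoGroup (dual_group :: ('n \<Rightarrow> complex) monoid))"
    by (intro group.AutoGroup comm_group.axioms(2)[OF comm_group_dual_group])
  then have pow: "dual_aut g [^]\<^bsub>AutoGroup dual_group\<^esub> (1 :: int) = dual_aut g"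
    using dual_aut_in_auto[OF g(2,1)] by (intro group.int_pow_1) (auto simp: AutoGroup_def)
  have "dual_aut g \<in> {dual_aut g [^]\<^bsub>AutoGroup dual_group\<^esub> n |n :: int. True}"
    using pow[symmetric] by (intro CollectI exI[of _ 1] conjI TrueI)
  with inv have gA: "dual_aut g ` A = A" by (rule bspec)
  have AK: "A \<subseteq> characters" using sets.sets_into_space[OF A] by (simp add: space_haar)
  have dg: "dual_aut g (c \<circ> g) = c" if "c \<in> characters" for c
    using characters_comp[OF that g(1)] g(2)
    by (auto simp: dual_aut_def fun_eq_iff bij_is_surj surj_f_inv_f)
  show "measure \<omega> A \<in> {0, 1}"
  proof (rule measure_invariant_set[OF g per A])
    fix c :: "'n \<Rightarrow> complex" assume c: "c \<in> characters"
    show "c \<circ> g \<in> A \<longleftrightarrow> c \<in> A"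
    proof
      assume "c \<circ> g \<in> A"
      then have "dual_aut g (c \<circ> g) \<in> A" using gA by blast
      then show "c \<in> A" by (simp only: dg[OF c])
    next
      assume "c \<in> A"
      then obtain d where d: "d \<in> A" "c = dual_aut g d" using gA by blast
      then have "c \<circ> g = d" using AK g(2) by (auto simp: dual_aut_def fun_eq_iff bij_is_inj)
      with d show "c \<circ> g \<in> A" by simp
    qed
  qed
qed

text \<open>The set where \<open>f\<close> is positive is invariant, hence null or conull; so
  \<open>f\<close> has constant sign almost everywhere, and its mean is zero.\<close>

lemma invariant_function_vanishes:
  fixes f :: "('n \<Rightarrow> complex) \<Rightarrow> real"
  assumes erg: "ergodic_action \<omega> (dual_aut ` \<Gamma>)"
    and \<Gamma>: "\<And>g. g \<in> \<Gamma> \<Longrightarrow> bij_betw (dual_aut g) characters characters"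
    and f: "continuous_on characters f" and inv: "\<And>g c. g \<in> \<Gamma> \<Longrightarrow> c \<in> characters \<Longrightarrow> f (dual_aut g c) = f c"
    and zero: "(LINT c|\<omega>. f c) = 0"
  shows "AE c in \<omega>. f c = 0"
proof -
  have fm: "f \<in> borel_measurable \<omega>" and fi: "integrable \<omega> f"
    using f by (auto intro: continuous_measurable continuous_integrable)
  define A where "A = {c \<in> space \<omega>. f c > 0}"
  have A: "A \<in> sets \<omega>" unfolding A_def using fm by measurable
  have "dual_aut g ` A = A" if g: "g \<in> \<Gamma>" for g
  proof -
    have bb: "dual_aut g ` characters = characters" using \<Gamma>[OF g] by (simp add: bij_betw_def)
    show ?thesis
    proof
      show "dual_aut g ` A \<subseteq> A" using bb inv[OF g] by (auto simp: A_def space_haar)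
      show "A \<subseteq> dual_aut g ` A"
      proof
        fix c assume c: "c \<in> A"
        then obtain d where "d \<in> characters" "c = dual_aut g d" using bb by (auto simp: A_def space_haar)
        with c inv[OF g] show "c \<in> dual_aut g ` A" by (auto simp: A_def space_haar)
      qed
    qed
  qed
  with erg A consider "measure \<omega> A = 0" | "measure \<omega> A = 1" by (auto simp: ergodic_action_def)
  then show ?thesis
  proof cases
    case 1
    then have "AE c in \<omega>. c \<notin> A" using A by (intro AE_not_in) (auto simp: null_sets_def emeasure_eq_measure)
    then have "AE c in \<omega>. 0 \<le> - f c" by (rule AE_mp) (auto simp: A_def)
    then have "AE c in \<omega>. - f c = 0"
      using integral_nonneg_eq_0_iff_AE[of \<omega> "\<lambda>c. - f c"] fi zero by auto
    then show ?thesis by simp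
  next
    case 2
    have "space \<omega> - A \<in> null_sets \<omega>"
      using 2 A finite_measure_compl[OF A] sets.compl_sets[OF A]
      by (auto simp: null_sets_def emeasure_eq_measure space_haar measure_characters)
    then have "AE c in \<omega>. c \<notin> space \<omega> - A" by (rule AE_not_in)
    then have "AE c in \<omega>. 0 \<le> f c" by (rule AE_mp) (auto simp: A_def)
    then show ?thesis using integral_nonneg_eq_0_iff_AE[of \<omega> f] fi zero by auto
  qed
qed

text \<open>The sum of the evaluations at \<open>S\<close> is invariant, and has mean zero because
  \<open>0 \<notin> S\<close>. Its real and imaginary parts therefore vanish almost everywhere,
  although its Fourier coefficient at \<open>b\<close> is 1.\<close>

theorem ergodic_no_finite_invariant_set:
  assumes erg: "ergodic_action \<omega> (dual_aut ` \<Gamma>)"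
    and \<Gamma>: "\<And>g a b. g \<in> \<Gamma> \<Longrightarrow> g (a + b) = g a + g (b :: 'n)" "\<And>g. g \<in> \<Gamma> \<Longrightarrow> bij g"
    and S: "finite S" "b \<in> S" "0 \<notin> S" "\<And>g. g \<in> \<Gamma> \<Longrightarrow> g ` S = S"
  shows False
proof -
  define f where "f c = (\<Sum>a\<in>S. c a)" for c :: "'n \<Rightarrow> complex"
  have cont: "continuous_on characters f"
    unfolding f_def by (intro continuous_on_sum continuous_evaluation)
  have bb: "bij_betw (dual_aut g) characters characters" if "g \<in> \<Gamma>" for g
    using \<Gamma>[OF that] by (intro dual_aut_bij)
  have inv: "f (dual_aut g c) = f c" if g: "g \<in> \<Gamma>" and c: "c \<in> characters" for g c
  proof -
    have "inj_on g S" using \<Gamma>(2)[OF g] by (meson bij_is_inj inj_on_subset subset_UNIV)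
    have "f (dual_aut g c) = (\<Sum>a\<in>g ` S. c (inv_into UNIV g a))"
      using c S(4)[OF g] by (simp add: f_def dual_aut_def)
    also have "\<dots> = f c"
      using \<open>inj_on g S\<close> \<Gamma>(2)[OF g] by (simp add: f_def sum.reindex bij_is_inj inv_f_f)
    finally show ?thesis .
  qed
  have int: "integrable \<omega> (\<lambda>c. c a)" for a by (intro continuous_integrable continuous_evaluation)
  have f0: "(LINT c|\<omega>. f c) = 0"
    unfolding f_def using S(3) by (subst Bochner_Integration.integral_sum[OF int]) (auto simp: integral_character intro!: sum.neutral)
  have fi: "integrable \<omega> f" by (rule continuous_integrable[OF cont])
  have re: "AE c in \<omega>. Re (f c) = 0"
    by (rule invariant_function_vanishes[OF erg bb]) (use cont inv f0 fi in \<open>auto intro: continuous_intros\<close>)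
  have im: "AE c in \<omega>. Im (f c) = 0"
    by (rule invariant_function_vanishes[OF erg bb]) (use cont inv f0 fi in \<open>auto intro: continuous_intros\<close>)
  from re im have ae: "AE c in \<omega>. f c = 0" by eventually_elim (simp add: complex_eq_iff)
  \<comment> \<open>The factor \<open>c (- b)\<close> is the conjugate of \<open>c b\<close> and
    extracts the coefficient at \<open>b\<close>.\<close>
  have "(LINT c|\<omega>. f c * c (- b)) = 0"
    using ae by (intro integral_eq_zero_AE) (auto elim: eventually_mono)
  moreover have "(LINT c|\<omega>. f c * c (- b)) = (LINT c|\<omega>. (\<Sum>a\<in>S. c (a - b)))"
  proof (rule Bochner_Integration.integral_cong)
    fix c assume "c \<in> space \<omega>"
    then have "c a * c (- b) = c (a - b)" for a
      using character_add[of c a "- b"] by (simp add: space_haar)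
    then show "f c * c (- b) = (\<Sum>a\<in>S. c (a - b))" by (simp add: f_def sum_distrib_right)
  qed simp
  moreover have "\<dots> = (\<Sum>a\<in>S. if a = b then 1 else 0)"
    by (subst Bochner_Integration.integral_sum[OF int]) (simp add: integral_character)
  ultimately show False using S(1,2) by simp
qed

end


section \<open>Invariant subgroups and ergodic elements\<close>

lemma (in module) bij_scale_unit:
  assumes "r * r' = 1" shows "bij (scale r)"
  by (rule o_bij[of "scale r'"]) (use assms in \<open>auto simp: fun_eq_iff mult.commute\<close>)

lemma scaled_monomial_aut_eq:
  assumes "Modules.module s"
  shows "scaled_monomial_aut s q n = s (laurent_const q * laurent_monomial n)"
proof -
  interpret Modules.module s by fact
  show ?thesis by (simp add: scaled_monomial_aut_def monomial_aut_def fun_eq_iff)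
qed

lemma scaled_monomial_unit:
  "q \<noteq> 0 \<Longrightarrow> (laurent_const q * laurent_monomial n) * (laurent_const (inverse q) * laurent_monomial (- n)) = 1"
  by (simp add: laurent_const_def laurent_monomial_def mult_single)

theorem DCC_scaled_monomials:
  fixes s :: "('d::finite, 'f::field) laurent \<Rightarrow> 'n::ab_group_add \<Rightarrow> 'n"
  assumes "finitely_generated_module s"
  shows "DCC_on dual_group dual_topology {dual_aut (scaled_monomial_aut s q n) | q n. q \<noteq> 0}"
  unfolding DCC_on_def
proof (intro allI impI, elim conjE)
  fix L :: "nat \<Rightarrow> ('n \<Rightarrow> complex) set"
  assume L: "\<forall>i. subgroup (L i) dual_group \<and> closedin dual_topology (L i) \<and>
      (\<forall>h\<in>{dual_aut (scaled_monomial_aut s q n) | q n. q \<noteq> 0}. h ` L i = L i)"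
    and dec: "\<forall>i. L (Suc i) \<subseteq> L i"
  have sub: "subgroup (L i) dual_group" and clo: "closedin dual_topology (L i)" for i using L by auto
  have LK: "L i \<subseteq> characters" for i by (rule subgroup.subset[OF sub])
  then have LI: "c \<in> characters" if "c \<in> L i" for c i using that by blast
  obtain B where B: "finite B" "module.span s B = UNIV" and "Modules.module s"
    using assms by (auto simp: finitely_generated_module_def)
  interpret Modules.module s by fact
  define M where "M i = {a. \<forall>c\<in>L i. c a = 1}" for i
  have "\<exists>n. \<forall>i. M (n + i) = M n"
  proof (rule span_chain_stabilizes[OF noetherian_laurent B(1)])
    show "M i \<subseteq> M j" if "i \<le> j" for i j
      using lift_Suc_antimono_le[of L, OF dec[rule_format] that] by (auto simp: M_def)
    show "subspace (M i)" for i
    proof (rule subspaceI)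
      show "0 \<in> M i" using character_zero[OF LI] by (simp add: M_def)
      show add: "a + b \<in> M i" if "a \<in> M i" "b \<in> M i" for a b
        using that by (auto simp: M_def character_add[OF LI[of _ i]])
      show "s r a \<in> M i" if a: "a \<in> M i" for r a
      proof (induction r rule: laurent_induct)
        case 1
        show ?case using character_zero[OF LI] by (simp add: M_def)
      next
        case (2 p q)
        then show ?case by (simp add: scale_left_distrib add)
      next
        case (3 q n)
        show ?case
        proof (cases "q = 0")
          case True
          then show ?thesis using character_zero[OF LI] by (simp add: M_def laurent_const_def)
        next
          case False
          let ?\<alpha> = "scaled_monomial_aut s q n"
          have \<alpha>: "?\<alpha> = s (laurent_const q * laurent_monomial n)"
            by (rule scaled_monomial_aut_eq) fact
          have inj: "inj ?\<alpha>"
            unfolding \<alpha> by (rule bij_is_inj[OF bij_scale_unit[OF scaled_monomial_unit[OF False]]])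
          have img: "dual_aut ?\<alpha> ` L i = L i" using L False by blast
          have "c (?\<alpha> a) = 1" if "c \<in> L i" for c
          proof -
            have "c \<in> dual_aut ?\<alpha> ` L i" using that by (simp only: img)
            then obtain d where d: "c = dual_aut ?\<alpha> d" "d \<in> L i" by (rule imageE)
            \<comment> \<open>Since \<open>c\<close> is \<open>d\<close> composed with the inverse
              of \<open>?\<alpha>\<close>, the annihilator inherits invariance from
              \<open>L i\<close>.\<close>
            then have "c (?\<alpha> a) = d a"
              using LI[OF d(2)] inj by (simp add: dual_aut_def)
            with d a show ?thesis by (simp add: M_def)
          qed
          then show ?thesis by (simp add: M_def \<alpha>)
        qed
      qed
    qed
  qed (simp add: B(2))
  then obtain n where n: "\<And>i. M (n + i) = M n" by blast
  have "L n \<subseteq> L (n + i)" for i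
  proof
    fix z assume z: "z \<in> L n"
    show "z \<in> L (n + i)"
    proof (rule closed_subgroup_biannihilator[OF sub clo])
      show "z \<in> characters" using z LK by blast
      show "z a = 1" if "\<forall>c\<in>L (n + i). c a = 1" for a
        using that z n[of i] by (auto simp: M_def)
    qed
  qed
  moreover have "L (n + i) \<subseteq> L n" for i
    by (rule lift_Suc_antimono_le[where f = L, OF dec[rule_format]]) simp
  ultimately have "L n = L (n + i)" for i by (rule subset_antisym)
  then show "\<exists>n. \<forall>i. L n = L (n + i)" by (intro exI allI)
qed

text \<open>The hypothesis \<open>gen\<close> is the only trace of \<open>S\<close> generating \<open>\<Gamma>\<close>.\<close>

theorem ergodic_element:
  fixes s :: "('d::finite, 'f::field) laurent \<Rightarrow> 'n::ab_group_add \<Rightarrow> 'n"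
  assumes fg: "finitely_generated_module s" and haar: "normalized_haar_measure dual_group dual_topology \<omega>"
    and \<Gamma>: "\<And>g. g \<in> \<Gamma> \<Longrightarrow> module_hom s s g" "\<And>g. g \<in> \<Gamma> \<Longrightarrow> bij g"
      "\<And>g h. g \<in> \<Gamma> \<Longrightarrow> h \<in> \<Gamma> \<Longrightarrow> g \<circ> h = h \<circ> g" "id \<in> \<Gamma>"
      "\<And>g h. g \<in> \<Gamma> \<Longrightarrow> h \<in> \<Gamma> \<Longrightarrow> g \<circ> h \<in> \<Gamma>"
    and S: "finite S" "S \<subseteq> \<Gamma>"
    and gen: "\<And>A g. finite A \<Longrightarrow> (\<And>h. h \<in> S \<Longrightarrow> h ` A = A) \<Longrightarrow> g \<in> \<Gamma> \<Longrightarrow> g ` A = A"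
    and erg: "ergodic_action \<omega> (dual_aut ` \<Gamma>)"
  shows "\<exists>g\<in>\<Gamma>. ergodic_automorphism dual_group \<omega> (dual_aut g)"
proof -
  obtain B where B: "finite B" "module.span s B = UNIV" and "Modules.module s"
    using fg by (auto simp: finitely_generated_module_def)
  interpret Modules.module s by fact
  interpret haar_dual \<omega> by (rule haar_dual.intro[OF haar])
  interpret commuting_injections s \<Gamma>
    by (intro commuting_injections.intro commuting_injections_axioms.intro \<Gamma>
        noetherian_sequence[OF noetherian_laurent B] bij_is_inj) fact
  have add: "g (a + b) = g a + g b" if "g \<in> \<Gamma>" for g a b
    using module_hom.add[OF \<Gamma>(1)[OF that]] .
  have "(\<Inter>g\<in>S. periodic_points g) \<subseteq> {0}"
  proof
    fix a assume "a \<in> (\<Inter>g\<in>S. periodic_points g)"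
    then have "\<forall>g\<in>S. a \<in> periodic_points g" by simp
    from finite_invariant_set[OF S this]
    obtain A where A: "finite A" "a \<in> A" "\<forall>g\<in>S. g ` A \<subseteq> A" "A \<subseteq> (\<lambda>g. g a) ` \<Gamma>"
      by (elim exE conjE)
    have img: "g ` A = A" if "g \<in> \<Gamma>" for g
    proof (rule gen[OF A(1) _ that])
      fix h assume h: "h \<in> S"
      then have "inj_on h A" using \<Gamma>(2) S(2) by (meson bij_is_inj inj_on_subset subset_UNIV subsetD)
      \<comment> \<open>An injective self-map of a finite set is onto; \<open>gen\<close> asks for
        this equality.\<close>
      with A h show "h ` A = A" by (intro endo_inj_surj) auto
    qed
    show "a \<in> {0}"
    proof (rule ccontr)
      assume "a \<notin> {0}"
      have "g a \<noteq> 0" if "g \<in> \<Gamma>" for g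
        using module_hom.zero[OF \<Gamma>(1)[OF that]] bij_is_inj[OF \<Gamma>(2)[OF that]] \<open>a \<notin> {0}\<close>
        by (metis injD singletonI)
      with A(4) have "0 \<notin> A" by auto
      show False
        by (rule ergodic_no_finite_invariant_set[OF erg add \<Gamma>(2) A(1,2) \<open>0 \<notin> A\<close> img])
    qed
  qed
  from aperiodic_exists[OF S this] obtain g where g: "g \<in> \<Gamma>" "periodic_points g \<subseteq> {0}"
    by (rule bexE)
  show ?thesis
    using ergodic_automorphism_if_aperiodic[OF add[OF g(1)] \<Gamma>(2)[OF g(1)] g(2)] g(1) by (rule bexI)
qed

text \<open>Equality of \<open>A\<close> with its image, in contrast to inclusion, passes to
  inverses and so from generators to the group.\<close>

lemma generate_preserves_set:
  assumes "g \<in> generate (module_aut_group s) S" and "Modules.module s" "S \<subseteq> carrier (module_aut_group s)"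
    and S: "\<And>h. h \<in> S \<Longrightarrow> h ` A = A"
  shows "g ` A = A"
  using assms(1)
proof induction
  case one
  then show ?case by (simp add: module_aut_group_def)
next
  case (incl h)
  then show ?case by (rule S)
next
  case (inv h)
  interpret group "module_aut_group s" by (rule group_module_aut_group) fact
  have "inv\<^bsub>module_aut_group s\<^esub> h \<otimes>\<^bsub>module_aut_group s\<^esub> h = \<one>\<^bsub>module_aut_group s\<^esub>"
    using inv assms(3) by (intro l_inv) blast
  then have "inv\<^bsub>module_aut_group s\<^esub> h \<circ> h = id" by (simp add: module_aut_group_def)
  then have "(inv\<^bsub>module_aut_group s\<^esub> h) ` h ` A = A" by (simp add: image_comp)
  then show ?case by (simp add: S[OF inv])
next
  case (eng g h)
  have "g ` h ` A = A" by (simp add: eng.IH)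
  then show ?case by (simp add: module_aut_group_def image_comp)
qed

section \<open>The group of monomial automorphisms\<close>

lemma monomial_aut_add:
  assumes "Modules.module s" shows "monomial_aut s (m + n) = monomial_aut s m \<circ> monomial_aut s n"
proof -
  interpret Modules.module s by fact
  show ?thesis by (simp add: monomial_aut_def fun_eq_iff laurent_monomial_add)
qed

lemma monomial_aut_0: "Modules.module s \<Longrightarrow> monomial_aut s 0 = id"
  by (simp add: monomial_aut_def fun_eq_iff laurent_monomial_0 module.scale_one)

lemma bij_monomial_aut: "Modules.module s \<Longrightarrow> bij (monomial_aut s n)"
  by (rule o_bij[of "monomial_aut s (- n)"]) (simp_all add: monomial_aut_0 flip: monomial_aut_add)

lemma monomial_aut_hom:
  assumes "Modules.module s" shows "module_hom s s (monomial_aut s n)"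
proof -
  interpret Modules.module s by fact
  show ?thesis
    by unfold_locales (simp_all add: monomial_aut_def scale_right_distrib mult.commute)
qed

lemma monomial_aut_preserves_set:
  fixes s :: "('d::finite, 'f::field) laurent \<Rightarrow> 'n::ab_group_add \<Rightarrow> 'n"
  assumes s: "Modules.module s" and A: "\<And>i. monomial_aut s (axis i 1) ` A = A"
  shows "monomial_aut s n ` A = A"
proof -
  have add: "monomial_aut s (m + n) ` A = A" if "monomial_aut s m ` A = A" "monomial_aut s n ` A = A" for m n
  proof -
    have "monomial_aut s (m + n) ` A = monomial_aut s m ` monomial_aut s n ` A"
      by (simp only: monomial_aut_add[OF s] image_comp)
    with that show ?thesis by simp
  qed
  have neg: "monomial_aut s (- n) ` A = A" if "monomial_aut s n ` A = A" for n
  proof -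
    have "monomial_aut s (- n) ` monomial_aut s n ` A = A"
      by (simp add: image_comp monomial_aut_0[OF s] flip: monomial_aut_add[OF s])
    with that show ?thesis by simp
  qed
  have ax: "monomial_aut s (axis i k) ` A = A" for i and k :: int
  proof (induction k rule: int_induct[where k = 0])
    case base
    then show ?case by (simp add: axis_0 monomial_aut_0[OF s])
  next
    case (step1 k)
    have "axis i (k + 1) = axis i k + axis i (1 :: int)" by (simp add: vec_eq_iff axis_def)
    with add[OF step1(2) A] show ?case by simp
  next
    case (step2 k)
    have "axis i (k - 1) = axis i k + - axis i (1 :: int)" by (simp add: vec_eq_iff axis_def)
    with add[OF step2(2) neg[OF A]] show ?case by simp
  qed
  have "monomial_aut s (\<Sum>i\<in>I. axis i (n $ i)) ` A = A" for I
    by (induction I rule: infinite_finite_induct) (simp_all add: monomial_aut_0[OF s] add ax)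
  from this[of UNIV] show ?thesis by (simp flip: vec_eq_sum_axis)
qed

theorem theorem5p4:
  fixes smult :: "('d::finite, 'f::{field, countable}) laurent \<Rightarrow> 'n::ab_group_add \<Rightarrow> 'n"
  assumes "finitely_generated_module smult"
  shows "DCC_on dual_group dual_topology
           {dual_aut (scaled_monomial_aut smult q n) | q n. q \<noteq> 0} \<and>
         (\<forall>\<omega> \<Gamma>. normalized_haar_measure dual_group dual_topology \<omega> \<and>
           finitely_generated_subgroup (module_aut_group smult) \<Gamma> \<and>
           comm_group ((module_aut_group smult)\<lparr>carrier := \<Gamma>\<rparr>) \<and>
           ergodic_action \<omega> (dual_aut ` \<Gamma>)
           \<longrightarrow> (\<exists>\<alpha>\<in>\<Gamma>. ergodic_automorphism dual_group \<omega> (dual_aut \<alpha>))) \<and>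
         (\<forall>\<omega>. normalized_haar_measure dual_group dual_topology \<omega> \<and>
           ergodic_action \<omega> (dual_aut ` {monomial_aut smult n | n. True})
           \<longrightarrow> (\<exists>n. ergodic_automorphism dual_group \<omega> (dual_aut (monomial_aut smult n))))"
proof (intro conjI allI impI; (elim conjE)?)
  have m: "Modules.module smult" using assms by (simp add: finitely_generated_module_def)
  show "DCC_on dual_group dual_topology {dual_aut (scaled_monomial_aut smult q n) | q n. q \<noteq> 0}"
    by (rule DCC_scaled_monomials[OF assms])
  fix \<omega> :: "('n \<Rightarrow> complex) measure"
  assume haar: "normalized_haar_measure dual_group dual_topology \<omega>"
  show "\<exists>\<alpha>\<in>\<Gamma>. ergodic_automorphism dual_group \<omega> (dual_aut \<alpha>)"
    if fg: "finitely_generated_subgroup (module_aut_group smult) \<Gamma>"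
      and comm: "comm_group ((module_aut_group smult)\<lparr>carrier := \<Gamma>\<rparr>)"
      and erg: "ergodic_action \<omega> (dual_aut ` \<Gamma>)" for \<Gamma>
  proof -
    obtain S where sub: "subgroup \<Gamma> (module_aut_group smult)"
      and S: "finite S" "S \<subseteq> \<Gamma>" "generate (module_aut_group smult) S = \<Gamma>"
      using fg by (auto simp: finitely_generated_subgroup_def)
    have \<Gamma>: "\<Gamma> \<subseteq> carrier (module_aut_group smult)" by (rule subgroup.subset[OF sub])
    show ?thesis
    proof (rule ergodic_element[OF assms haar _ _ _ _ _ S(1,2) _ erg])
      show "module_hom smult smult g" "bij g" if "g \<in> \<Gamma>" for g
        using \<Gamma> that by (auto simp: module_aut_group_def)
      show "g \<circ> h = h \<circ> g" if "g \<in> \<Gamma>" "h \<in> \<Gamma>" for g h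
        using comm_monoid.m_comm[OF comm_group.axioms(1)[OF comm], of g h] that
        by (simp add: module_aut_group_def)
      show "id \<in> \<Gamma>" using subgroup.one_closed[OF sub] by (simp add: module_aut_group_def)
      show "g \<circ> h \<in> \<Gamma>" if "g \<in> \<Gamma>" "h \<in> \<Gamma>" for g h
        using subgroup.m_closed[OF sub that] by (simp add: module_aut_group_def)
      show "g ` A = A" if "\<And>h. h \<in> S \<Longrightarrow> h ` A = A" "g \<in> \<Gamma>" for A g
        using generate_preserves_set[OF _ m, of g S A] that S \<Gamma> by blast
    qed
  qed
  show "\<exists>n. ergodic_automorphism dual_group \<omega> (dual_aut (monomial_aut smult n))"
    if erg: "ergodic_action \<omega> (dual_aut ` {monomial_aut smult n | n. True})"
  proof -
    have "\<exists>g\<in>{monomial_aut smult n | n. True}. ergodic_automorphism dual_group \<omega> (dual_aut g)"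
    \<comment> \<open>The multiplications by the variables serve as the finite generating
      set.\<close>
    proof (rule ergodic_element[OF assms haar, of _ "range (\<lambda>i. monomial_aut smult (axis i 1))"])
      show "module_hom smult smult g" "bij g" if "g \<in> {monomial_aut smult n | n. True}" for g
        using that by (auto intro: monomial_aut_hom[OF m] bij_monomial_aut[OF m])
      show "g \<circ> h = h \<circ> g" "g \<circ> h \<in> {monomial_aut smult n | n. True}"
        if "g \<in> {monomial_aut smult n | n. True}" "h \<in> {monomial_aut smult n | n. True}" for g h
        using that by (auto simp: add.commute simp flip: monomial_aut_add[OF m])
      show "id \<in> {monomial_aut smult n | n. True}"
        using monomial_aut_0[OF m, symmetric] by blast
      show "g ` A = A" if A: "\<And>h. h \<in> range (\<lambda>i. monomial_aut smult (axis i 1)) \<Longrightarrow> h ` A = A"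
        and g: "g \<in> {monomial_aut smult n | n. True}" for A g
      proof -
        obtain n where "g = monomial_aut smult n" using g by blast
        moreover have "monomial_aut smult n ` A = A"
          by (rule monomial_aut_preserves_set[OF m]) (rule A, rule rangeI)
        ultimately show ?thesis by simp
      qed
    qed (use erg in auto)
    then show ?thesis by blast
  qed
qed

end
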